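(* If $D$ is a (fixed) disjoint union of spiders, then the problem $\Pi_D$ (given a digraph $G$, does $G$ contain an induced subdivision of $D$?) is polynomial-time solvable.
   Context: All digraphs are finite and simple (no loops, no parallel arcs), but may contain directed 2-cycles (pairs of arcs $ab$, $ba$). A subdivision of a digraph $D$ is a digraph obtained from $D$ by replacing each arc $ab$ by a directed $(a,b)$-path of length at least 1, these paths being internally disjoint with new internal vertices. An induced subdivision of $D$ in $G$ is an induced subdigraph of $G$ that is (isomorphic to) a subdivision of $D$. For a fixed digraph $D$, $\Pi_D$ is the decision problem: Input: a digraph $G$ (2-cycles allowed). Question: does $G$ contain an induced subdivision of $D$? A vertex of a digraph is a node if its out-degree or its in-degree is at least 2. A spider is an oriented tree (a digraph whose underlying undirected graph is a tree) having at most one node. *)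

theory Defs
  imports "Graph_Theory.Graph_Theory" "HOL-Computational_Algebra.Polynomial"
begin

section \<open>Spiders\<close>

text \<open>
  Digraphs are values of type \<^typ>\<open>'a pair_pre_digraph\<close> satisfying \<^const>\<open>pair_digraph\<close>: finite and
  loopless, with arcs given as ordered pairs (hence no parallel arcs); directed 2-cycles are
  allowed, and so is the empty digraph.
\<close>

text \<open>
  The library predicate \<^const>\<open>tree\<close> is not usable here: \<^const>\<open>forest\<close> only excludes directed cycles,
  and in a symmetric digraph an edge traversed back and forth already counts as a cycle. A cycle
  of the underlying undirected graph is therefore a cycle of length at least 3 in
  \<^const>\<open>mk_symmetric\<close>. The library predicate \<^const>\<open>Digraph_Component.connected\<close> refers to the
  underlying undirected graph, and includes nonemptiness.
\<close>

definition oriented_tree :: "'a pair_pre_digraph \<Rightarrow> bool" where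
  "oriented_tree T \<longleftrightarrow>
     pair_digraph T \<and>
     (\<forall>u v. (u, v) \<in> parcs T \<longrightarrow> (v, u) \<notin> parcs T) \<and>
     Digraph_Component.connected (with_proj T) \<and>
     \<not> (\<exists>p. pre_digraph.cycle (with_proj (mk_symmetric (with_proj T))) p \<and> 3 \<le> length p)"

definition is_node :: "'a pair_pre_digraph \<Rightarrow> 'a \<Rightarrow> bool" where
  "is_node G v \<longleftrightarrow> v \<in> pverts G \<and> (2 \<le> out_degree (with_proj G) v \<or> 2 \<le> in_degree (with_proj G) v)"

definition spider :: "'a pair_pre_digraph \<Rightarrow> bool" where
  "spider T \<longleftrightarrow> oriented_tree T \<and> (\<forall>u v. is_node T u \<and> is_node T v \<longrightarrow> u = v)"

definition disjoint_union_of_spiders :: "'a pair_pre_digraph \<Rightarrow> bool" where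
  "disjoint_union_of_spiders D \<longleftrightarrow>
     (\<exists>F. finite F \<and> (\<forall>T\<in>F. spider T) \<and>
          (\<forall>S\<in>F. \<forall>T\<in>F. S \<noteq> T \<longrightarrow> pverts S \<inter> pverts T = {}) \<and>
          pverts D = (\<Union>T\<in>F. pverts T) \<and> parcs D = (\<Union>T\<in>F. parcs T))"


section \<open>Induced subdivisions\<close>

text \<open>
  \<open>subdivision_of D H\<close>: \<open>H\<close> is isomorphic to a subdivision of \<open>D\<close>. Here \<open>\<phi>\<close> gives the copies of the
  vertices of \<open>D\<close>, and \<open>P e\<close> is the directed path (a list of arcs) replacing the arc \<open>e\<close>.
  The library's \<^const>\<open>subdivision\<close> is restricted to bidirected digraphs, where an arc and its
  reverse are always subdivided together.
\<close>

definition subdivision_of :: "'a pair_pre_digraph \<Rightarrow> 'b pair_pre_digraph \<Rightarrow> bool" where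
  "subdivision_of D H \<longleftrightarrow>
     (\<exists>(\<phi> :: 'a \<Rightarrow> 'b) (P :: 'a \<times> 'a \<Rightarrow> ('b \<times> 'b) awalk).
        inj_on \<phi> (pverts D) \<and>
        (\<forall>(a, b) \<in> parcs D.
           pre_digraph.apath (with_proj H) (\<phi> a) (P (a, b)) (\<phi> b) \<and> 1 \<le> length (P (a, b))) \<and>
        (\<forall>e \<in> parcs D.
           set (pre_digraph.inner_verts (with_proj H) (P e)) \<inter> \<phi> ` pverts D = {}) \<and>
        (\<forall>e \<in> parcs D. \<forall>f \<in> parcs D. e \<noteq> f \<longrightarrow>
           set (pre_digraph.inner_verts (with_proj H) (P e)) \<inter>
           set (pre_digraph.inner_verts (with_proj H) (P f)) = {}) \<and>
        pverts H = \<phi> ` pverts D \<union>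
          (\<Union>e \<in> parcs D. set (pre_digraph.inner_verts (with_proj H) (P e))) \<and>
        parcs H = (\<Union>e \<in> parcs D. set (P e)))"

definition contains_induced_subdivision ::
    "'b pair_pre_digraph \<Rightarrow> 'a pair_pre_digraph \<Rightarrow> bool" where
  "contains_induced_subdivision G D \<longleftrightarrow>
     (\<exists>H. induced_subgraph (with_proj H) (with_proj G) \<and> subdivision_of D H)"


section \<open>Polynomial time\<close>

text \<open>
  Random access machines. The input is a word over \<^typ>\<open>bool\<close> on a read-only input tape with
  random access; the memory consists of registers holding natural numbers, all initially 0.
  Every instruction costs one time unit. As there is no multiplication, the largest stored
  number at most doubles in one step (up to the constants of the program), so this unit-cost model is polynomially equivalent to
  Turing machines (Cook and Reckhow).
\<close>

datatype instr =
    Const nat nat       \<comment> \<open>\<open>Const i c\<close>: \<open>r\<^sub>i := c\<close>\<close>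
  | Add nat nat nat     \<comment> \<open>\<open>Add i j k\<close>: \<open>r\<^sub>i := r\<^sub>j + r\<^sub>k\<close>\<close>
  | Sub nat nat nat     \<comment> \<open>\<open>Sub i j k\<close>: \<open>r\<^sub>i := max 0 (r\<^sub>j - r\<^sub>k)\<close>\<close>
  | Load nat nat        \<comment> \<open>\<open>Load i j\<close>: \<open>r\<^sub>i :=\<close> contents of the register with index \<open>r\<^sub>j\<close>\<close>
  | Store nat nat       \<comment> \<open>\<open>Store i j\<close>: the register with index \<open>r\<^sub>i\<close> is set to \<open>r\<^sub>j\<close>\<close>
  | Input nat nat       \<comment> \<open>\<open>Input i j\<close>: \<open>r\<^sub>i := 0, 1, 2\<close> if the input cell with index \<open>r\<^sub>j\<close> (from 0)
                             is past the end of the input, \<^term>\<open>False\<close>, \<^term>\<open>True\<close>, respectively\<close>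
  | Jump_zero nat nat   \<comment> \<open>\<open>Jump_zero i l\<close>: go to instruction \<open>l\<close> if \<open>r\<^sub>i = 0\<close>\<close>

text \<open>A configuration consists of the program counter and the register contents.\<close>

type_synonym config = "nat \<times> (nat \<Rightarrow> nat)"

fun exec :: "bool list \<Rightarrow> instr \<Rightarrow> config \<Rightarrow> config" where
  "exec w (Const i c) (pc, r) = (Suc pc, r(i := c))"
| "exec w (Add i j k) (pc, r) = (Suc pc, r(i := r j + r k))"
| "exec w (Sub i j k) (pc, r) = (Suc pc, r(i := r j - r k))"
| "exec w (Load i j) (pc, r) = (Suc pc, r(i := r (r j)))"
| "exec w (Store i j) (pc, r) = (Suc pc, r(r i := r j))"
| "exec w (Input i j) (pc, r) =
     (Suc pc, r(i := if r j < length w then if w ! r j then 2 else 1 else 0))"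
| "exec w (Jump_zero i l) (pc, r) = (if r i = 0 then l else Suc pc, r)"

definition step :: "instr list \<Rightarrow> bool list \<Rightarrow> config \<Rightarrow> config" where
  "step prog w c = (if fst c < length prog then exec w (prog ! fst c) c else c)"

text \<open>
  The machine halts when the program counter leaves the program (such configurations are fixed
  points of \<^const>\<open>step\<close>), and accepts iff register 0 is then nonzero.
\<close>

definition decides_within :: "instr list \<Rightarrow> (nat \<Rightarrow> nat) \<Rightarrow> bool list set \<Rightarrow> bool" where
  "decides_within prog T L \<longleftrightarrow>
     (\<forall>w. \<exists>t \<le> T (length w). \<exists>pc r.
        (step prog w ^^ t) (0, \<lambda>_. 0) = (pc, r) \<and> length prog \<le> pc \<and> (r 0 \<noteq> 0 \<longleftrightarrow> w \<in> L))"

definition polynomial_time_solvable :: "bool list set \<Rightarrow> bool" where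
  "polynomial_time_solvable L \<longleftrightarrow> (\<exists>prog (p :: nat poly). decides_within prog (poly p) L)"


section \<open>The decision problem\<close>

text \<open>
  Input digraphs have vertex set \<open>{0..<n}\<close> and are presented by their adjacency matrix, read row by
  row; the word has length \<open>n\<^sup>2\<close>, so it determines the digraph. As usual, a decision problem is
  identified with the set of the encodings of its yes-instances.
\<close>

definition adjacency_word :: "nat pair_pre_digraph \<Rightarrow> bool list" where
  "adjacency_word G =
     (let n = card (pverts G)
      in concat (map (\<lambda>u. map (\<lambda>v. (u, v) \<in> parcs G) [0..<n]) [0..<n]))"

definition input_digraph :: "nat pair_pre_digraph \<Rightarrow> bool" where
  "input_digraph G \<longleftrightarrow> pair_digraph G \<and> pverts G = {0..<card (pverts G)}"

definition induced_subdivision_problem :: "'a pair_pre_digraph \<Rightarrow> bool list set" where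
  "induced_subdivision_problem D =
     {adjacency_word G | G. input_digraph G \<and> contains_induced_subdivision G D}"

end

theory Submission
  imports Defs
begin

text \<open>
  In a subdivision of a spider every leg is a directed path at least as long as the original leg, so
  cutting the legs at their original lengths leaves an induced copy of the spider. Hence a digraph
  contains an induced subdivision of a disjoint union \<open>D\<close> of spiders iff it contains \<open>D\<close> itself as an
  induced subdigraph, which is decided by trying all maps from the vertices of \<open>D\<close>: their number is
  polynomial because \<open>D\<close> is fixed.
\<close>

section \<open>Program fragments and their running time\<close>

text \<open>The cut must respect the whole leg rather than its single arcs: the vertex at distance
  \<open>d\<close> from its centre goes to position \<open>d\<close> of the concatenated subdivision
  paths, wherever one path ends and the next begins. That the copy is induced is where the shape of
  spiders enters. Away from the centres, a vertex on the subdivision of a leg leaving a centre has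
  exactly one in-neighbour, and dually for legs entering a centre. Every arc of the subdivision
  enters a vertex of the first kind or leaves one of the second, so one of its ends determines the
  other, and no additional arc can join two chosen vertices. On the algorithmic side no complete
  program is analysed. Functions computed with polynomial bounds are closed under bounded sums; a
  bounded quantifier says that a bounded sum of truth values is positive, and the search over maps
  becomes a fixed number of nested quantifiers. Values are bounded together with running times
  because a computed value may serve as the bound of a loop.\<close>

definition runs ::
    "(nat \<Rightarrow> instr list) \<Rightarrow> bool list \<Rightarrow> (nat \<Rightarrow> nat) \<Rightarrow> nat \<Rightarrow> (nat \<Rightarrow> nat) \<Rightarrow> bool" where
  "runs C w r t r' \<longleftrightarrow>
     (\<forall>A B. (step (A @ C (length A) @ B) w ^^ t) (length A, r) =
            (length A + length (C (length A)), r'))"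

lemma runs_instr:
  assumes "\<And>pc. exec w i (pc, r) = (Suc pc, r')"
  shows "runs (\<lambda>_. [i]) w r 1 r'"
  using assms by (simp add: runs_def step_def)

text \<open>Jump targets are absolute, so a fragment is a function of its load address, and the
  second fragment is instantiated at the address where the first one ends.\<close>

definition seq :: "(nat \<Rightarrow> instr list) \<Rightarrow> (nat \<Rightarrow> instr list) \<Rightarrow> nat \<Rightarrow> instr list" (infixr \<open>;;\<close> 60)
  where "(C ;; D) b = C b @ D (b + length (C b))"

text \<open>Because \<open>runs\<close> quantifies over the surrounding code, each of the two
  fragments can count the other as part of its surroundings.\<close>

lemma runs_seq:
  assumes "runs C w r s r'" "runs D w r' t r''"
  shows "runs (C ;; D) w r (s + t) r''"
  unfolding runs_def
proof (intro allI)
  fix A B :: "instr list"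
  let ?b = "length A + length (C (length A))"
  let ?P = "A @ (C ;; D) (length A) @ B"
  have 1: "(step ?P w ^^ s) (length A, r) = (?b, r')"
    using assms(1) by (simp add: runs_def seq_def)
  have 2: "(step ?P w ^^ t) (?b, r') = (?b + length (D ?b), r'')"
    using assms(2)[unfolded runs_def, rule_format, of "A @ C (length A)" B] by (simp add: seq_def)
  show "(step ?P w ^^ (s + t)) (length A, r) =
      (length A + length ((C ;; D) (length A)), r'')"
    by (subst add.commute) (simp add: funpow_add 1 2, simp add: seq_def)
qed

text \<open>Register \<open>z\<close> is zeroed after the body, which makes the backward jump unconditional.\<close>

definition while_nonzero :: "nat \<Rightarrow> nat \<Rightarrow> (nat \<Rightarrow> instr list) \<Rightarrow> nat \<Rightarrow> instr list" where
  "while_nonzero z i C b =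
     Jump_zero i (b + length (C (Suc b)) + 3) # C (Suc b) @ [Const z 0, Jump_zero z b]"

lemma runs_while_exit:
  assumes "r i = 0"
  shows "runs (while_nonzero z i C) w r 1 r"
  using assms by (simp add: runs_def step_def while_nonzero_def)

text \<open>The three extra steps are the test at the head of the loop and the two instructions that
  close it. The remaining run starts with \<open>z\<close> zeroed, as the backward jump leaves
  it.\<close>

lemma runs_while_iterate:
  assumes "r i \<noteq> 0" "runs C w r s r'" "runs (while_nonzero z i C) w (r'(z := 0)) t r''"
  shows "runs (while_nonzero z i C) w r (s + t + 3) r''"
  unfolding runs_def
proof (intro allI)
  fix A B :: "instr list"
  let ?W = "while_nonzero z i C"
  let ?n = "length (C (Suc (length A)))"
  define P where "P = A @ ?W (length A) @ B"
  have P: "P = A @ (Jump_zero i (length A + ?n + 3) # C (Suc (length A)) @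
      [Const z 0, Jump_zero z (length A)]) @ B"
    by (simp add: P_def while_nonzero_def)
  have 1: "(step P w ^^ 1) (length A, r) = (Suc (length A), r)"
    using assms(1) by (simp add: P step_def)
  have 2: "(step P w ^^ s) (Suc (length A), r) = (Suc (length A) + ?n, r')"
    using assms(2)[unfolded runs_def, rule_format, of "A @ [Jump_zero i (length A + ?n + 3)]"
        "[Const z 0, Jump_zero z (length A)] @ B"] by (simp add: P)
  have P': "P = (A @ Jump_zero i (length A + ?n + 3) # C (Suc (length A))) @
      Const z 0 # Jump_zero z (length A) # B" by (simp add: P)
  have c: "P ! (Suc (length A) + ?n) = Const z 0"
    "P ! (Suc (Suc (length A) + ?n)) = Jump_zero z (length A)"
    "Suc (Suc (length A) + ?n) < length P"
    unfolding P' by (simp_all add: nth_append)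
  have 3: "(step P w ^^ 2) (Suc (length A) + ?n, r') = (length A, r'(z := 0))"
    using c by (simp add: step_def numeral_2_eq_2)
  have 4: "(step P w ^^ t) (length A, r'(z := 0)) = (length A + length (?W (length A)), r'')"
    using assms(3) by (simp add: runs_def P_def)
  \<comment> \<open>\<open>funpow_add\<close> applies the right summand first, so the phases of the
    iteration appear in reverse order.\<close>
  have "(step P w ^^ (t + (2 + (s + 1)))) (length A, r) =
      (length A + length (?W (length A)), r'')"
    unfolding funpow_add comp_apply 1 2 3 4 ..
  then show "(step (A @ ?W (length A) @ B) w ^^ (s + t + 3)) (length A, r) =
      (length A + length (?W (length A)), r'')"
    unfolding P_def by (simp add: ac_simps numeral_3_eq_3)
qed

section \<open>Polynomial-time computable functions\<close>

text \<open>\<open>\<rho> i\<close> is the register holding the variable \<open>i\<close> of the environment; registers below \<open>k\<close> are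
  preserved and the result is delivered in register \<open>k\<close>.\<close>

definition computable :: "(bool list \<Rightarrow> (nat \<Rightarrow> nat) \<Rightarrow> nat) \<Rightarrow> bool" where
  "computable f \<longleftrightarrow> (\<forall>\<rho> k. (\<forall>i. \<rho> i < k) \<longrightarrow> (\<exists>C p. \<forall>w r B.
     length w \<le> B \<longrightarrow> (\<forall>i. r (\<rho> i) \<le> B) \<longrightarrow>
     (\<exists>t r'. runs C w r t r' \<and> t \<le> poly p B \<and> (\<forall>i<k. r' i = r i) \<and>
        r' k = f w (\<lambda>i. r (\<rho> i)) \<and> r' k \<le> poly p B)))"

lemma computableI:
  assumes "\<And>\<rho> k. \<forall>i. \<rho> i < k \<Longrightarrow> \<exists>C p. \<forall>w r B.
     length w \<le> B \<longrightarrow> (\<forall>i. r (\<rho> i) \<le> B) \<longrightarrow>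
     (\<exists>t r'. runs C w r t r' \<and> t \<le> poly p B \<and> (\<forall>i<k. r' i = r i) \<and>
        r' k = f w (\<lambda>i. r (\<rho> i)) \<and> r' k \<le> poly p B)"
  shows "computable f"
  using assms unfolding computable_def by blast

lemma computableE:
  assumes "computable f" "\<forall>i. \<rho> i < k"
  obtains C p where "\<And>w r B. length w \<le> B \<Longrightarrow> \<forall>i. r (\<rho> i) \<le> B \<Longrightarrow>
     \<exists>t r'. runs C w r t r' \<and> t \<le> poly p B \<and> (\<forall>i<k. r' i = r i) \<and>
        r' k = f w (\<lambda>i. r (\<rho> i)) \<and> r' k \<le> poly p B"
  using assms unfolding computable_def by blast

text \<open>Code reaches variables only through the register assignment, so it suffices to compile
  \<open>f\<close> for \<rho> composed with \<sigma>.\<close>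

lemma computable_rename:
  assumes "computable f"
  shows "computable (\<lambda>w e. f w (\<lambda>i. e (\<sigma> i)))"
proof (rule computableI)
  fix \<rho> :: "nat \<Rightarrow> nat" and k
  assume "\<forall>i. \<rho> i < k"
  then have "\<forall>i. (\<rho> \<circ> \<sigma>) i < k" by simp
  from computableE[OF assms this] obtain C p where "\<And>w r B. length w \<le> B \<Longrightarrow>
     \<forall>i. r ((\<rho> \<circ> \<sigma>) i) \<le> B \<Longrightarrow>
     \<exists>t r'. runs C w r t r' \<and> t \<le> poly p B \<and> (\<forall>i<k. r' i = r i) \<and>
        r' k = f w (\<lambda>i. r ((\<rho> \<circ> \<sigma>) i)) \<and> r' k \<le> poly p B" by blast
  then show "\<exists>C p. \<forall>w r B. length w \<le> B \<longrightarrow> (\<forall>i. r (\<rho> i) \<le> B) \<longrightarrow>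
     (\<exists>t r'. runs C w r t r' \<and> t \<le> poly p B \<and> (\<forall>i<k. r' i = r i) \<and>
        r' k = f w (\<lambda>i. r (\<rho> (\<sigma> i))) \<and> r' k \<le> poly p B)" 
    by (intro exI[of _ C] exI[of _ p]) auto
qed

lemma computable_var: "computable (\<lambda>w e. e v)"
proof (rule computableI)
  fix \<rho> :: "nat \<Rightarrow> nat" and k
  assume \<rho>: "\<forall>i. \<rho> i < k"
  \<comment> \<open>The machine copies a register by clearing the target and adding; the source
    survives the clearing because its index is below \<open>k\<close>.\<close>
  let ?C = "(\<lambda>_. [Const k 0]) ;; (\<lambda>_. [Add k k (\<rho> v)])"
  have run: "runs ?C w r (1 + 1) (r(k := r (\<rho> v)))" for w r
    by (rule runs_seq; rule runs_instr) (use \<rho> less_irrefl in \<open>force+\<close>)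
  show "\<exists>C p. \<forall>w r B. length w \<le> B \<longrightarrow> (\<forall>i. r (\<rho> i) \<le> B) \<longrightarrow>
     (\<exists>t r'. runs C w r t r' \<and> t \<le> poly p B \<and> (\<forall>i<k. r' i = r i) \<and>
        r' k = r (\<rho> v) \<and> r' k \<le> poly p B)"
  proof (intro exI[of _ ?C] exI[of _ "[:2, 1:]"] allI impI)
    fix w :: "bool list" and r :: "nat \<Rightarrow> nat" and B :: nat
    assume "\<forall>i. r (\<rho> i) \<le> B"
    then have "r (\<rho> v) \<le> poly [:2, 1:] B" by (simp add: trans_le_add2 le_SucI)
    then show "\<exists>t r'. runs ?C w r t r' \<and> t \<le> poly [:2, 1:] B \<and> (\<forall>i<k. r' i = r i) \<and>
        r' k = r (\<rho> v) \<and> r' k \<le> poly [:2, 1:] B"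
      by (intro exI[of _ "1 + 1"] exI[of _ "r(k := r (\<rho> v))"] conjI run) simp_all
  qed
qed

lemma computable_const: "computable (\<lambda>w e. c)"
proof (rule computableI)
  fix \<rho> :: "nat \<Rightarrow> nat" and k
  have "runs (\<lambda>_. [Const k c]) w r 1 (r(k := c))" for w r by (rule runs_instr) simp
  then show "\<exists>C p. \<forall>w r B. length w \<le> B \<longrightarrow> (\<forall>i. r (\<rho> i) \<le> B) \<longrightarrow>
     (\<exists>t r'. runs C w r t r' \<and> t \<le> poly p B \<and> (\<forall>i<k. r' i = r i) \<and> r' k = c \<and> r' k \<le> poly p B)"
    by (intro exI[of _ "\<lambda>_. [Const k c]"] exI[of _ "[:1 + c:]"] allI impI exI conjI)
      (assumption | simp)+
qed

lemma computable_input: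
  assumes "computable f"
  shows "computable (\<lambda>w e. if f w e < length w then if w ! f w e then 2 else 1 else 0)"
proof (rule computableI)
  fix \<rho> :: "nat \<Rightarrow> nat" and k
  assume \<rho>: "\<forall>i. \<rho> i < k"
  from computableE[OF assms this] obtain C p where C: "\<And>w r B. length w \<le> B \<Longrightarrow>
     \<forall>i. r (\<rho> i) \<le> B \<Longrightarrow>
     \<exists>t r'. runs C w r t r' \<and> t \<le> poly p B \<and> (\<forall>i<k. r' i = r i) \<and>
        r' k = f w (\<lambda>i. r (\<rho> i)) \<and> r' k \<le> poly p B" by blast
  let ?D = "C ;; (\<lambda>_. [Input k k])"
  show "\<exists>C p. \<forall>w r B. length w \<le> B \<longrightarrow> (\<forall>i. r (\<rho> i) \<le> B) \<longrightarrow>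
     (\<exists>t r'. runs C w r t r' \<and> t \<le> poly p B \<and> (\<forall>i<k. r' i = r i) \<and>
        r' k = (if f w (\<lambda>i. r (\<rho> i)) < length w
           then if w ! f w (\<lambda>i. r (\<rho> i)) then 2 else 1 else 0) \<and> r' k \<le> poly p B)"
  proof (intro exI[of _ ?D] exI[of _ "p + [:2:]"] allI impI)
    fix w :: "bool list" and r :: "nat \<Rightarrow> nat" and B :: nat
    assume "length w \<le> B" "\<forall>i. r (\<rho> i) \<le> B"
    from C[OF this] obtain t r' where r': "runs C w r t r'" "t \<le> poly p B" "\<forall>i<k. r' i = r i"
        "r' k = f w (\<lambda>i. r (\<rho> i))" by blast
    have "runs ?D w r (t + 1)
        (r'(k := if r' k < length w then if w ! r' k then 2 else 1 else 0))"
      by (rule runs_seq[OF r'(1)]) (rule runs_instr, simp)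
    then show "\<exists>t r'. runs ?D w r t r' \<and> t \<le> poly (p + [:2:]) B \<and> (\<forall>i<k. r' i = r i) \<and>
        r' k = (if f w (\<lambda>i. r (\<rho> i)) < length w
           then if w ! f w (\<lambda>i. r (\<rho> i)) then 2 else 1 else 0) \<and> r' k \<le> poly (p + [:2:]) B"
      using r' by - (intro exI conjI, assumption, auto)
  qed
qed

text \<open>Compiling \<open>g\<close> with result register \<open>Suc k\<close> protects the value
  of \<open>f\<close> waiting in register \<open>k\<close>. The assumption
  \<open>h x y \<le> x + y\<close> keeps the result polynomially bounded.\<close>

lemma computable_binary:
  assumes f: "computable f" and g: "computable g"
    and op: "\<And>i j k w r pc. exec w (I i j k) (pc, r) = (Suc pc, r(i := h (r j) (r k)))"
      "\<And>x y. h x y \<le> x + y"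
  shows "computable (\<lambda>w e. h (f w e) (g w e))"
proof (rule computableI)
  fix \<rho> :: "nat \<Rightarrow> nat" and k
  assume \<rho>: "\<forall>i. \<rho> i < k"
  from computableE[OF f this] obtain C p where C: "\<And>w r B. length w \<le> B \<Longrightarrow>
     \<forall>i. r (\<rho> i) \<le> B \<Longrightarrow>
     \<exists>t r'. runs C w r t r' \<and> t \<le> poly p B \<and> (\<forall>i<k. r' i = r i) \<and>
        r' k = f w (\<lambda>i. r (\<rho> i)) \<and> r' k \<le> poly p B" by blast
  from \<rho> have "\<forall>i. \<rho> i < Suc k" using less_SucI by blast
  from computableE[OF g this] obtain D q where D: "\<And>w r B. length w \<le> B \<Longrightarrow>
     \<forall>i. r (\<rho> i) \<le> B \<Longrightarrow>
     \<exists>t r'. runs D w r t r' \<and> t \<le> poly q B \<and> (\<forall>i<Suc k. r' i = r i) \<and>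
        r' (Suc k) = g w (\<lambda>i. r (\<rho> i)) \<and> r' (Suc k) \<le> poly q B" by blast
  let ?E = "C ;; D ;; (\<lambda>_. [I k k (Suc k)])"
  show "\<exists>C p. \<forall>w r B. length w \<le> B \<longrightarrow> (\<forall>i. r (\<rho> i) \<le> B) \<longrightarrow>
     (\<exists>t r'. runs C w r t r' \<and> t \<le> poly p B \<and> (\<forall>i<k. r' i = r i) \<and>
        r' k = h (f w (\<lambda>i. r (\<rho> i))) (g w (\<lambda>i. r (\<rho> i))) \<and> r' k \<le> poly p B)"
  proof (intro exI[of _ ?E] exI[of _ "p + q + 1"] allI impI)
    fix w :: "bool list" and r :: "nat \<Rightarrow> nat" and B :: nat
    assume B: "length w \<le> B" "\<forall>i. r (\<rho> i) \<le> B"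
    from C[OF this] obtain s r1 where r1: "runs C w r s r1" "s \<le> poly p B" "\<forall>i<k. r1 i = r i"
        "r1 k = f w (\<lambda>i. r (\<rho> i))" "r1 k \<le> poly p B" by blast
    with \<rho> have e: "(\<lambda>i. r1 (\<rho> i)) = (\<lambda>i. r (\<rho> i))" by simp
    from D[OF B(1), of r1] B(2) fun_cong[OF e] obtain t r2
      where r2: "runs D w r1 t r2" "t \<le> poly q B" "\<forall>i<Suc k. r2 i = r1 i"
        "r2 (Suc k) = g w (\<lambda>i. r (\<rho> i))" "r2 (Suc k) \<le> poly q B" unfolding e by metis
    have "runs ?E w r (s + (t + 1)) (r2(k := h (r2 k) (r2 (Suc k))))"
      by (rule runs_seq[OF r1(1)], rule runs_seq[OF r2(1)]) (rule runs_instr, simp add: op)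
    moreover have "h (r2 k) (r2 (Suc k)) \<le> poly (p + q + 1) B"
      using op(2)[of "r2 k" "r2 (Suc k)"] r1(5) r2(3,5) by simp
    ultimately show "\<exists>t r'. runs ?E w r t r' \<and> t \<le> poly (p + q + 1) B \<and> (\<forall>i<k. r' i = r i) \<and>
        r' k = h (f w (\<lambda>i. r (\<rho> i))) (g w (\<lambda>i. r (\<rho> i))) \<and> r' k \<le> poly (p + q + 1) B"
      using r1(2-4) r2(2-4) by - (intro exI conjI, assumption, auto)
  qed
qed

lemma computable_add:
  "computable f \<Longrightarrow> computable g \<Longrightarrow> computable (\<lambda>w e. f w e + g w e)"
  by (rule computable_binary[where I = Add]) auto

lemma computable_diff:
  "computable f \<Longrightarrow> computable g \<Longrightarrow> computable (\<lambda>w e. f w e - g w e)"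
  by (rule computable_binary[where I = Sub]) auto

text \<open>\<open>Input\<close> yields 0 exactly past the end of the word, so the length is found
  by scanning.\<close>

lemma computable_length: "computable (\<lambda>w e. length w)"
proof (rule computableI)
  fix \<rho> :: "nat \<Rightarrow> nat" and k
  \<comment> \<open>Register \<open>k\<close> counts cells and \<open>k+2\<close> holds the cell
    under the counter. Register \<open>k+1\<close> holds the constant 1 and doubles as the zeroed
    register of the loop, hence it is set anew in each round.\<close>
  let ?body = "(\<lambda>_. [Const (k+1) 1]) ;; (\<lambda>_. [Add k k (k+1)]) ;; (\<lambda>_. [Input (k+2) k])"
  let ?W = "while_nonzero (k+1) (k+2) ?body"
  let ?C = "(\<lambda>_. [Const k 0]) ;; (\<lambda>_. [Input (k+2) k]) ;; ?W"
  \<comment> \<open>A round costs three body instructions and three steps of loop overhead; the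
    final 1 is the failing test.\<close>
  have loop: "\<exists>r'. runs ?W w r (6 * (length w - r k) + 1) r' \<and> (\<forall>i<k. r' i = r i) \<and> r' k = length w"
    if "r k \<le> length w" "r (k+2) \<noteq> 0 \<longleftrightarrow> r k < length w" for w r
    using that
  proof (induction "length w - r k" arbitrary: r)
    case 0
    then have "runs ?W w r 1 r" by (intro runs_while_exit) auto
    with 0 show ?case by (intro exI[of _ r]) auto
  next
    case (Suc n)
    let ?r1 = "r(k+1 := 1, k := Suc (r k))"
    let ?r = "?r1(k+2 := if Suc (r k) < length w then if w ! Suc (r k) then 2 else 1 else 0)"
    have body: "runs ?body w r (1 + (1 + 1)) ?r"
      by (rule runs_seq[where r' = "r(k+1 := 1)"], rule runs_instr, simp,
          rule runs_seq[where r' = ?r1], rule runs_instr, simp, rule runs_instr, simp)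
    have "\<exists>r'. runs ?W w (?r(k+1 := 0)) (6 * (length w - (?r(k+1 := 0)) k) + 1) r' \<and>
        (\<forall>i<k. r' i = (?r(k+1 := 0)) i) \<and> r' k = length w"
      by (rule Suc.hyps(1)) (use Suc.hyps(2) in auto)
    then obtain r' where r': "runs ?W w (?r(k+1 := 0)) (6 * (length w - Suc (r k)) + 1) r'"
      "\<forall>i<k. r' i = r i" "r' k = length w" by auto
    have "r (k+2) \<noteq> 0" using Suc by simp
    from runs_while_iterate[OF this body r'(1)]
    have "runs ?W w r (6 * (length w - r k) + 1) r'"
      by (rule back_subst[where P = "\<lambda>t. runs ?W w r t r'"]) (use Suc.hyps(2) in simp)
    with r' show ?case by blast
  qed
  show "\<exists>C p. \<forall>w r B. length w \<le> B \<longrightarrow> (\<forall>i. r (\<rho> i) \<le> B) \<longrightarrow>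
     (\<exists>t r'. runs C w r t r' \<and> t \<le> poly p B \<and> (\<forall>i<k. r' i = r i) \<and>
        r' k = length w \<and> r' k \<le> poly p B)"
  proof (intro exI[of _ ?C] exI[of _ "[:3, 6:]"] allI impI)
    fix w :: "bool list" and r :: "nat \<Rightarrow> nat" and B :: nat
    assume B: "length w \<le> B"
    define c :: nat where "c = (if 0 < length w then if w ! 0 then 2 else 1 else 0)"
    let ?r = "r(k := 0, k+2 := c)"
    have "?r k \<le> length w" "?r (k+2) \<noteq> 0 \<longleftrightarrow> ?r k < length w" by (auto simp: c_def)
    from loop[OF this] obtain r' where "runs ?W w ?r (6 * (length w - ?r k) + 1) r'"
      "\<forall>i<k. r' i = ?r i" "r' k = length w" by blast
    moreover have "?r k = 0" by simp
    ultimately have r': "runs ?W w ?r (6 * length w + 1) r'" "\<forall>i<k. r' i = r i" "r' k = length w"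
      by simp_all
    have "runs ?C w r (1 + (1 + (6 * length w + 1))) r'"
      by (rule runs_seq[where r' = "r(k := 0)"], rule runs_instr, simp,
          rule runs_seq[OF _ r'(1)], rule runs_instr, simp add: c_def)
    with r' B show "\<exists>t r'. runs ?C w r t r' \<and> t \<le> poly [:3, 6:] B \<and> (\<forall>i<k. r' i = r i) \<and>
        r' k = length w \<and> r' k \<le> poly [:3, 6:] B"
      by - (intro exI conjI, assumption, auto)
  qed
qed

text \<open>This closure property yields multiplication and bounded quantification. The summation
  index becomes variable 0 and the other variables are shifted up, in de Bruijn style.\<close>

lemma computable_sum:
  assumes f: "computable f" and g: "computable g"
  shows "computable (\<lambda>w e. \<Sum>x<f w e. g w (case_nat x e))"
proof (rule computableI)
  fix \<rho> :: "nat \<Rightarrow> nat" and k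
  assume \<rho>: "\<forall>i. \<rho> i < k"
  from computableE[OF f this] obtain C p where C: "\<And>w r B. length w \<le> B \<Longrightarrow>
     \<forall>i. r (\<rho> i) \<le> B \<Longrightarrow>
     \<exists>t r'. runs C w r t r' \<and> t \<le> poly p B \<and> (\<forall>i<k. r' i = r i) \<and>
        r' k = f w (\<lambda>i. r (\<rho> i)) \<and> r' k \<le> poly p B" by blast
  from \<rho> have "\<forall>i. case_nat k \<rho> i < k + 3" by (auto split: nat.split simp: trans_less_add1)
  from computableE[OF g this] obtain D q where D: "\<And>w r B. length w \<le> B \<Longrightarrow>
     \<forall>i. r (case_nat k \<rho> i) \<le> B \<Longrightarrow>
     \<exists>t r'. runs D w r t r' \<and> t \<le> poly q B \<and> (\<forall>i<k+3. r' i = r i) \<and>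
        r' (k+3) = g w (\<lambda>i. r (case_nat k \<rho> i)) \<and> r' (k+3) \<le> poly q B" by blast
  \<comment> \<open>Register \<open>k\<close> is the counter and, once decremented, the summation
    index seen by \<open>g\<close>; \<open>k+1\<close> accumulates, \<open>k+2\<close> holds the
    constant 1 and is the zeroed register, and \<open>D\<close> delivers its value in
    \<open>k+3\<close>.\<close>
  let ?body = "(\<lambda>_. [Const (k+2) 1]) ;; (\<lambda>_. [Sub k k (k+2)]) ;; D ;; (\<lambda>_. [Add (k+1) (k+1) (k+3)])"
  let ?W = "while_nonzero (k+2) k ?body"
  \<comment> \<open>The loop leaves 0 in register \<open>k\<close>, so the last \<open>Add\<close>
    moves the sum into the result register.\<close>
  let ?E = "C ;; (\<lambda>_. [Const (k+1) 0]) ;; ?W ;; (\<lambda>_. [Add k (k+1) k])"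
  \<comment> \<open>Besides \<open>D\<close>, a round takes three body instructions and three steps
    of overhead, which gives the constant 6.\<close>
  have loop: "\<exists>t r'. runs ?W w r t r' \<and> t \<le> r k * (poly q B + 6) + 1 \<and> (\<forall>i<k. r' i = r i) \<and>
      r' k = 0 \<and> r' (k+1) = r (k+1) + (\<Sum>x<r k. g w (case_nat x (\<lambda>i. r (\<rho> i)))) \<and>
      r' (k+1) \<le> r (k+1) + r k * poly q B"
    if "length w \<le> B" "\<forall>i. r (\<rho> i) \<le> B" "r k \<le> B" for w r B
    using that
  proof (induction "r k" arbitrary: r)
    case 0
    then have "runs ?W w r 1 r" by (intro runs_while_exit) auto
    with 0 show ?case by (intro exI[of _ "1::nat"] exI[of _ r]) auto
  next
    case (Suc n)
    let ?r = "r(k+2 := 1, k := n)"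
    have \<rho>': "\<rho> i \<noteq> k" "\<rho> i \<noteq> Suc k" "\<rho> i \<noteq> Suc (Suc k)" for i
      using \<rho>[rule_format, of i] by auto
    have e: "(\<lambda>i. ?r (case_nat k \<rho> i)) = case_nat n (\<lambda>i. r (\<rho> i))"
      using \<rho>' by (auto simp: fun_eq_iff split: nat.split)
    have "\<forall>i. ?r (case_nat k \<rho> i) \<le> B"
      using Suc unfolding fun_cong[OF e] by (auto split: nat.split)
    from D[OF Suc.prems(1) this] obtain t r1 where r1: "runs D w ?r t r1" "t \<le> poly q B"
      "\<forall>i<k+3. r1 i = ?r i" "r1 (k+3) = g w (case_nat n (\<lambda>i. r (\<rho> i)))" "r1 (k+3) \<le> poly q B"
      unfolding e by blast
    let ?r2 = "r1(k+1 := r1 (k+1) + r1 (k+3))"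
    have body: "runs ?body w r (1 + (1 + (t + 1))) ?r2"
      by (rule runs_seq[where r' = "r(k+2 := 1)"], rule runs_instr, simp,
          rule runs_seq[where r' = ?r], rule runs_instr, use Suc.hyps(2)[symmetric] in simp,
          rule runs_seq[OF r1(1)], rule runs_instr, simp)
    let ?r3 = "?r2(k+2 := 0)"
    have r3: "(\<lambda>i. ?r3 (\<rho> i)) = (\<lambda>i. r (\<rho> i))" "?r3 k = n"
      using \<rho> r1(3) \<rho>' by (auto simp: fun_eq_iff trans_less_add1)
    have "\<exists>t r'. runs ?W w ?r3 t r' \<and> t \<le> ?r3 k * (poly q B + 6) + 1 \<and> (\<forall>i<k. r' i = ?r3 i) \<and>
      r' k = 0 \<and> r' (k+1) = ?r3 (k+1) + (\<Sum>x<?r3 k. g w (case_nat x (\<lambda>i. ?r3 (\<rho> i)))) \<and>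
      r' (k+1) \<le> ?r3 (k+1) + ?r3 k * poly q B"
      by (rule Suc.hyps(1)) (use Suc.hyps(2) Suc.prems fun_cong[OF r3(1)] r3(2) in \<open>simp_all\<close>)
    then obtain s r' where r': "runs ?W w ?r3 s r'" "s \<le> n * (poly q B + 6) + 1"
      "\<forall>i<k. r' i = ?r3 i" "r' k = 0"
      "r' (k+1) = ?r3 (k+1) + (\<Sum>x<n. g w (case_nat x (\<lambda>i. r (\<rho> i))))"
      "r' (k+1) \<le> ?r3 (k+1) + n * poly q B" unfolding r3 by blast
    have acc: "?r3 (k+1) = r (k+1) + g w (case_nat n (\<lambda>i. r (\<rho> i)))"
      "?r3 (k+1) \<le> r (k+1) + poly q B" using r1 by auto
    have "r k \<noteq> 0" using Suc.hyps(2) by simp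
    from runs_while_iterate[OF this body r'(1)]
    have "runs ?W w r (1 + (1 + (t + 1)) + s + 3) r'" .
    moreover have "1 + (1 + (t + 1)) + s + 3 \<le> r k * (poly q B + 6) + 1"
      using r1(2) r'(2) by (simp flip: Suc.hyps(2))
    moreover have "\<forall>i<k. r' i = r i" using r'(3) r1(3) by auto
    moreover have "r' (k+1) = r (k+1) + (\<Sum>x<r k. g w (case_nat x (\<lambda>i. r (\<rho> i))))"
      unfolding r'(5) acc(1) by (simp flip: Suc.hyps(2))
    moreover have "r' (k+1) \<le> r (k+1) + r k * poly q B"
      using r'(6) acc(2) unfolding Suc.hyps(2)[symmetric] by simp
    ultimately show ?case using r'(4) by blast
  qed
  \<comment> \<open>The index can be as large as the value of \<open>f\<close>, so \<open>g\<close>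
    sees values up to \<open>B + poly p B\<close>; hence the composition of \<open>q\<close> with
    \<open>[:0, 1:] + p\<close>.\<close>
  let ?P = "p + 4 + p * (pcompose q ([:0, 1:] + p) + 6)"
  show "\<exists>C p. \<forall>w r B. length w \<le> B \<longrightarrow> (\<forall>i. r (\<rho> i) \<le> B) \<longrightarrow>
     (\<exists>t r'. runs C w r t r' \<and> t \<le> poly p B \<and> (\<forall>i<k. r' i = r i) \<and>
        r' k = (\<Sum>x<f w (\<lambda>i. r (\<rho> i)). g w (case_nat x (\<lambda>i. r (\<rho> i)))) \<and> r' k \<le> poly p B)"
  proof (intro exI[of _ ?E] exI[of _ ?P] allI impI)
    fix w :: "bool list" and r :: "nat \<Rightarrow> nat" and B :: nat
    assume B: "length w \<le> B" "\<forall>i. r (\<rho> i) \<le> B"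
    from C[OF this] obtain s r1 where r1: "runs C w r s r1" "s \<le> poly p B" "\<forall>i<k. r1 i = r i"
        "r1 k = f w (\<lambda>i. r (\<rho> i))" "r1 k \<le> poly p B" by blast
    let ?B = "B + poly p B"
    let ?r = "r1(k+1 := 0)"
    have "?r (\<rho> i) = r (\<rho> i)" for i
      using \<rho>[rule_format, of i] r1(3) by auto
    then have r: "(\<lambda>i. ?r (\<rho> i)) = (\<lambda>i. r (\<rho> i))" "?r k = f w (\<lambda>i. r (\<rho> i))"
      using r1(4) by simp_all
    have "\<forall>i. r (\<rho> i) \<le> ?B" using B(2) trans_le_add1 by blast
    then have "length w \<le> ?B" "\<forall>i. ?r (\<rho> i) \<le> ?B" "?r k \<le> ?B"
      using B(1) r1(5) unfolding fun_cong[OF r(1)] by simp_all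
    from loop[OF this] obtain t r2 where "runs ?W w ?r t r2" "t \<le> ?r k * (poly q ?B + 6) + 1"
      "\<forall>i<k. r2 i = ?r i" "r2 k = 0"
      "r2 (k+1) = ?r (k+1) + (\<Sum>x<?r k. g w (case_nat x (\<lambda>i. ?r (\<rho> i))))"
      "r2 (k+1) \<le> ?r (k+1) + ?r k * poly q ?B" by blast
    moreover have "?r (k+1) = 0" by simp
    ultimately have r2: "runs ?W w ?r t r2" "t \<le> r1 k * (poly q ?B + 6) + 1"
      "\<forall>i<k. r2 i = r i" "r2 k = 0"
      "r2 (k+1) = (\<Sum>x<f w (\<lambda>i. r (\<rho> i)). g w (case_nat x (\<lambda>i. r (\<rho> i))))"
      "r2 (k+1) \<le> r1 k * poly q ?B" using r1(3) unfolding r by (simp_all add: r1(4))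
    let ?r' = "r2(k := r2 (k+1) + r2 k)"
    have run: "runs ?E w r (s + (1 + (t + 1))) ?r'"
      by (rule runs_seq[OF r1(1)], rule runs_seq[where r' = ?r], rule runs_instr, simp,
          rule runs_seq[OF r2(1)], rule runs_instr, simp)
    have P: "poly ?P B = poly p B + 4 + poly p B * (poly q ?B + 6)"
      by (simp add: poly_pcompose)
    have "r1 k * (poly q ?B + 6) \<le> poly p B * (poly q ?B + 6)"
      "r1 k * poly q ?B \<le> poly p B * (poly q ?B + 6)"
      using r1(5) by (auto intro: mult_le_mono)
    then have bounds: "s + (1 + (t + 1)) \<le> poly ?P B" "r2 (k+1) + r2 k \<le> poly ?P B"
      unfolding P using r1(2) r2(2,4,6) by linarith+
    show "\<exists>t r'. runs ?E w r t r' \<and> t \<le> poly ?P B \<and> (\<forall>i<k. r' i = r i) \<and>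
        r' k = (\<Sum>x<f w (\<lambda>i. r (\<rho> i)). g w (case_nat x (\<lambda>i. r (\<rho> i)))) \<and> r' k \<le> poly ?P B"
    proof (intro exI[of _ "s + (1 + (t + 1))"] exI[of _ ?r'] conjI)
      show "\<forall>i<k. ?r' i = r i" using r2(3) by simp
      show "?r' k = (\<Sum>x<f w (\<lambda>i. r (\<rho> i)). g w (case_nat x (\<lambda>i. r (\<rho> i))))"
        unfolding fun_upd_same r2(4,5) by simp
      show "?r' k \<le> poly ?P B" unfolding fun_upd_same by (rule bounds(2))
    qed (rule run bounds(1))+
  qed
qed

text \<open>A product is a sum of equal terms; renaming by \<open>Suc\<close> hides the summation
  index from \<open>g\<close>.\<close>

lemma computable_times:
  assumes "computable f" "computable g"
  shows "computable (\<lambda>w e. f w e * g w e)"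
  using computable_sum[OF assms(1) computable_rename[OF assms(2), of Suc]] by simp

lemma computable_imp_polynomial_time_solvable:
  assumes "computable f"
  shows "polynomial_time_solvable {w. f w (\<lambda>_. 0) \<noteq> 0}"
proof -
  \<comment> \<open>All variables share register 0, which initially holds the required value 0; the
    result then arrives in register 1.\<close>
  have "\<forall>i. (\<lambda>_. 0) i < (1 :: nat)" by simp
  from computableE[OF assms this] obtain C p where C: "\<And>w r B. length w \<le> B \<Longrightarrow> \<forall>i::nat. r 0 \<le> B \<Longrightarrow>
     \<exists>t r'. runs C w r t r' \<and> t \<le> poly p B \<and> (\<forall>i<1. r' i = r i) \<and>
        r' 1 = f w (\<lambda>i. r 0) \<and> r' 1 \<le> poly p B" by blast
  \<comment> \<open>Acceptance is read off register 0. It still contains 0 after \<open>C\<close>,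
    so the addition copies the result there.\<close>
  let ?D = "C ;; (\<lambda>_. [Add 0 1 0])"
  have "decides_within (?D 0) (poly (p + 1)) {w. f w (\<lambda>_. 0) \<noteq> 0}"
    unfolding decides_within_def
  proof
    fix w
    from C[of w "length w" "\<lambda>_. 0"] obtain t r' where r': "runs C w (\<lambda>_. 0) t r'"
      "t \<le> poly p (length w)" "r' 0 = 0" "r' 1 = f w (\<lambda>_. 0)" by auto
    have "runs ?D w (\<lambda>_. 0) (t + 1) (r'(0 := r' 1 + r' 0))"
      by (rule runs_seq[OF r'(1)]) (rule runs_instr, simp)
    from this[unfolded runs_def, rule_format, of "[]" "[]"]
    have "(step (?D 0) w ^^ (t + 1)) (0, \<lambda>_. 0) = (length (?D 0), r'(0 := r' 1 + r' 0))" by simp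
    moreover have "t + 1 \<le> poly (p + 1) (length w)" using r'(2) by simp
    moreover have "(r'(0 := r' 1 + r' 0)) 0 \<noteq> 0 \<longleftrightarrow> w \<in> {w. f w (\<lambda>_. 0) \<noteq> 0}"
      using r'(3,4) by simp
    ultimately show "\<exists>t\<le>poly (p + 1) (length w). \<exists>pc r. (step (?D 0) w ^^ t) (0, \<lambda>_. 0) = (pc, r) \<and>
        length (?D 0) \<le> pc \<and> (r 0 \<noteq> 0 \<longleftrightarrow> w \<in> {w. f w (\<lambda>_. 0) \<noteq> 0})"
      by blast
  qed
  then show ?thesis unfolding polynomial_time_solvable_def by blast
qed

section \<open>Decidable predicates and bounded quantifiers\<close>

definition decidable :: "(bool list \<Rightarrow> (nat \<Rightarrow> nat) \<Rightarrow> bool) \<Rightarrow> bool" where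
  "decidable P \<longleftrightarrow> computable (\<lambda>w e. of_bool (P w e))"

lemma decidable_not:
  assumes "decidable P" shows "decidable (\<lambda>w e. \<not> P w e)"
proof -
  have "of_bool (\<not> b) = 1 - (of_bool b :: nat)" for b by simp
  then show ?thesis
    using computable_diff[OF computable_const[of 1] assms[unfolded decidable_def]]
    unfolding decidable_def by presburger
qed

lemma decidable_conj:
  assumes "decidable P" "decidable Q" shows "decidable (\<lambda>w e. P w e \<and> Q w e)"
  using computable_times[OF assms[unfolded decidable_def]] by (simp add: decidable_def of_bool_conj)

lemma decidable_const: "decidable (\<lambda>w e. c)"
  unfolding decidable_def by (rule computable_const)

lemma decidable_positive:
  assumes "computable f" shows "decidable (\<lambda>w e. 0 < f w e)"
proof -
  have "of_bool (0 < x) = 1 - (1 - x)" for x :: nat by simp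
  then show ?thesis unfolding decidable_def
    by (auto intro!: computable_diff computable_const assms)
qed

lemma decidable_less:
  assumes "computable f" "computable g" shows "decidable (\<lambda>w e. f w e < g w e)"
  using decidable_positive[OF computable_diff[OF assms(2,1)]] by simp

lemma decidable_eq:
  assumes "computable f" "computable g" shows "decidable (\<lambda>w e. f w e = g w e)"
proof -
  have "x = y \<longleftrightarrow> \<not> x < y \<and> \<not> y < x" for x y :: nat by auto
  then show ?thesis by (simp only:) (intro decidable_conj decidable_not decidable_less assms)
qed

lemma decidable_eq_const: "decidable P \<Longrightarrow> decidable (\<lambda>w e. P w e = c)"
  by (cases c) (simp_all add: decidable_not)

lemma decidable_input:
  assumes "computable f" shows "decidable (\<lambda>w e. f w e < length w \<and> w ! f w e)"
proof -
  have "f w e < length w \<and> w ! f w e \<longleftrightarrow>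
      1 < (if f w e < length w then if w ! f w e then 2 else 1 else 0 :: nat)" for w e by simp
  then show ?thesis
    by (simp only:) (intro decidable_less computable_const computable_input assms)
qed

text \<open>A bounded existential statement holds iff the sum of its truth values is positive. The
  renaming \<open>?\<sigma>\<close> turns the index 0 used by sums into the named variable
  \<open>v\<close>.\<close>

lemma decidable_Ex_less:
  assumes "computable f" "decidable P"
  shows "decidable (\<lambda>w e. \<exists>x<f w e. P w (e(v := x)))"
proof -
  let ?\<sigma> = "\<lambda>i. if i = v then 0 else Suc i"
  have "computable (\<lambda>w e. \<Sum>x<f w e. of_bool (P w (\<lambda>i. case_nat x e (?\<sigma> i))))"
    by (rule computable_sum[OF assms(1) computable_rename[OF assms(2)[unfolded decidable_def]]])
  moreover have "(\<lambda>i. case_nat x e (?\<sigma> i)) = e(v := x)" for x :: nat and e by auto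
  ultimately have "decidable (\<lambda>w e. 0 < (\<Sum>x<f w e. of_bool (P w (e(v := x))) :: nat))"
    by (simp only: decidable_positive)
  moreover have "0 < (\<Sum>x<n. of_bool (Q x) :: nat) \<longleftrightarrow> (\<exists>x<n. Q x)" for n :: nat and Q
    by (induction n) (auto simp: less_Suc_eq)
  ultimately show ?thesis by (simp only:)
qed

lemma decidable_All_less:
  assumes "computable f" "decidable P"
  shows "decidable (\<lambda>w e. \<forall>x<f w e. P w (e(v := x)))"
  using decidable_not[OF decidable_Ex_less[OF assms(1) decidable_not[OF assms(2)]], of v] by simp

lemma decidable_Ball_finite:
  fixes k :: nat
  assumes "\<And>i. i < k \<Longrightarrow> decidable (P i)"
  shows "decidable (\<lambda>w e. \<forall>i<k. P i w e)"
  using assms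
proof (induction k)
  case 0
  show ?case by (simp add: decidable_const)
next
  case (Suc k)
  then show ?case by (simp add: less_Suc_eq all_conj_distrib imp_disjL decidable_conj)
qed

text \<open>The tuple occupies the variables below \<open>k\<close>, and \<open>k \<le> n\<close>
  keeps the bound \<open>e n\<close> from being overwritten. Each component costs one more nested
  quantifier, which stays polynomial because \<open>k\<close> is a constant of the program.\<close>

lemma decidable_Ex_tuple:
  assumes "decidable P" "k \<le> n"
  shows "decidable (\<lambda>w e. \<exists>e'. (\<forall>i<k. e' i < e n) \<and> (\<forall>i\<ge>k. e' i = e i) \<and> P w e')"
  using assms(2)
proof (induction k)
  case 0
  have "(\<exists>e'. (\<forall>i<0. e' i < e n) \<and> (\<forall>i\<ge>0. e' i = e i) \<and> P w e') \<longleftrightarrow> P w e" for w e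
    by (auto simp: fun_eq_iff[symmetric])
  then show ?case using assms(1) by simp
next
  case (Suc k)
  have "(\<exists>e'. (\<forall>i<Suc k. e' i < e n) \<and> (\<forall>i\<ge>Suc k. e' i = e i) \<and> P w e') \<longleftrightarrow>
      (\<exists>x<e n. \<exists>e'. (\<forall>i<k. e' i < (e(k := x)) n) \<and> (\<forall>i\<ge>k. e' i = (e(k := x)) i) \<and> P w e')"
    (is "?L \<longleftrightarrow> ?R") for w e
  proof
    assume ?L
    then obtain e' where e': "\<forall>i<Suc k. e' i < e n" "\<forall>i\<ge>Suc k. e' i = e i" "P w e'" by blast
    with Suc.prems show ?R
      by (intro exI[of _ "e' k"] conjI exI[of _ e']) auto
  next
    assume ?R
    then obtain x e' where e': "x < e n" "\<forall>i<k. e' i < (e(k := x)) n"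
      "\<forall>i\<ge>k. e' i = (e(k := x)) i" "P w e'" by blast
    with Suc.prems show ?L by (intro exI[of _ e']) (auto simp: less_Suc_eq)
  qed
  then show ?case
    using decidable_Ex_less[OF computable_var[of n] Suc.IH, of k] Suc.prems by simp
qed

lemma decidable_imp_polynomial_time_solvable:
  "decidable P \<Longrightarrow> polynomial_time_solvable {w. P w (\<lambda>_. 0)}"
  using computable_imp_polynomial_time_solvable[of "\<lambda>w e. of_bool (P w e)"]
  by (simp add: decidable_def)

text \<open>The first two conditions single out the words that encode loopless digraphs;
  \<open>n\<close> is found by search instead of computing a square root. The relation
  \<open>A\<close> is hardwired into the program.\<close>

lemma polynomial_time_induced_embedding:
  fixes A :: "nat \<Rightarrow> nat \<Rightarrow> bool" and k :: nat
  shows "polynomial_time_solvable {w. \<exists>n. n * n = length w \<and> (\<forall>u<n. \<not> w ! (u * n + u)) \<and>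
     (\<exists>x. (\<forall>i<k. x i < n) \<and>
       (\<forall>i<k. \<forall>j<k. (x i = x j \<longleftrightarrow> i = j) \<and> (w ! (x i * n + x j) \<longleftrightarrow> A i j)))}"
proof -
  \<comment> \<open>The program can only test cells inside the word, whereas \<open>!\<close> is
    unspecified outside; the two readings agree once \<open>n * n = length w\<close>.\<close>
  let ?bit = "\<lambda>w i. i < length w \<and> w ! i"
  let ?Q = "\<lambda>w x n. \<forall>i<k. \<forall>j<k. (x i = x j) = (i = j) \<and> ?bit w (x i * n + x j) = A i j"
  \<comment> \<open>Variable \<open>k\<close> holds \<open>n\<close>, \<open>Suc k\<close> the
    diagonal index, and the variables below \<open>k\<close> the tuple. The updates stay unreduced
    so that the formula has the shape produced by the quantifier rules.\<close>
  let ?P = "\<lambda>w e. \<exists>n<length w + 1. (e(k := n)) k * (e(k := n)) k = length w \<and>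
     (\<forall>u<(e(k := n)) k. \<not> ?bit w ((e(k := n, Suc k := u)) (Suc k) * (e(k := n, Suc k := u)) k +
        (e(k := n, Suc k := u)) (Suc k))) \<and>
     (\<exists>x. (\<forall>i<k. x i < (e(k := n)) k) \<and> (\<forall>i\<ge>k. x i = (e(k := n)) i) \<and> ?Q w x (x k))"
  have "decidable ?P"
    by (intro decidable_Ex_less decidable_All_less decidable_Ex_tuple decidable_Ball_finite
      decidable_conj decidable_not decidable_eq decidable_eq_const decidable_input
      computable_add computable_times computable_length computable_var computable_const order_refl)
  from decidable_imp_polynomial_time_solvable[OF this]
  have "polynomial_time_solvable {w. ?P w (\<lambda>_. 0)}" .
  moreover have "?P w (\<lambda>_. 0) \<longleftrightarrow> (\<exists>n. n * n = length w \<and> (\<forall>u<n. \<not> w ! (u * n + u)) \<and>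
     (\<exists>x. (\<forall>i<k. x i < n) \<and>
       (\<forall>i<k. \<forall>j<k. (x i = x j \<longleftrightarrow> i = j) \<and> (w ! (x i * n + x j) \<longleftrightarrow> A i j))))" for w
  proof -
    have lt: "u * n + v < length w" if "n * n = length w" "u < n" "v < n" for u v n
    proof -
      have "u * n + v < Suc u * n" using that by simp
      also have "\<dots> \<le> n * n" using that by (intro mult_le_mono) auto
      finally show ?thesis using that by simp
    qed
    show ?thesis
    proof
      assume "?P w (\<lambda>_. 0)"
      then obtain n x where n: "n * n = length w" and d: "\<forall>u<n. \<not> ?bit w (u * n + u)"
        and x: "\<forall>i<k. x i < n" "x k = n" "?Q w x (x k)" by auto
      have "\<forall>u<n. \<not> w ! (u * n + u)" using d lt[OF n] by blast
      moreover have "\<forall>i<k. \<forall>j<k. (x i = x j \<longleftrightarrow> i = j) \<and> (w ! (x i * n + x j) \<longleftrightarrow> A i j)"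
        using x lt[OF n] by auto
      ultimately show "\<exists>n. n * n = length w \<and> (\<forall>u<n. \<not> w ! (u * n + u)) \<and>
        (\<exists>x. (\<forall>i<k. x i < n) \<and>
       (\<forall>i<k. \<forall>j<k. (x i = x j \<longleftrightarrow> i = j) \<and> (w ! (x i * n + x j) \<longleftrightarrow> A i j)))"
        using n x(1) by blast
    next
      assume "\<exists>n. n * n = length w \<and> (\<forall>u<n. \<not> w ! (u * n + u)) \<and>
        (\<exists>x. (\<forall>i<k. x i < n) \<and>
       (\<forall>i<k. \<forall>j<k. (x i = x j \<longleftrightarrow> i = j) \<and> (w ! (x i * n + x j) \<longleftrightarrow> A i j)))"
      then obtain n x where n: "n * n = length w" and d: "\<forall>u<n. \<not> w ! (u * n + u)"
        and x: "\<forall>i<k. x i < n"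
        "\<forall>i<k. \<forall>j<k. (x i = x j \<longleftrightarrow> i = j) \<and> (w ! (x i * n + x j) \<longleftrightarrow> A i j)" by blast
      \<comment> \<open>The tuple is completed to an environment: \<open>n\<close> sits in variable
        \<open>k\<close>, and the default 0 agrees with the initial environment.\<close>
      define y where "y = (\<lambda>i. if i < k then x i else if i = k then n else 0)"
      have "n < length w + 1" using n by (metis le_square less_Suc_eq_le Suc_eq_plus1)
      moreover have "?Q w y (y k)" using x lt[OF n] by (simp add: y_def)
      ultimately show "?P w (\<lambda>_. 0)"
        using n d x by (intro exI[of _ n] conjI exI[of _ y]) (auto simp: y_def)
    qed
  qed
  ultimately show ?thesis by simp
qed

section \<open>Induced copies in subdivisions of spiders\<close>

text \<open>
  \<open>C\<close> contains one centre per spider: its node, or any vertex of a directed path. The axioms are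
  invariant under reversing all arcs, which turns the legs leaving the centres into the legs
  entering them.
\<close>

locale spider_forest =
  fixes V :: "'a set" and A :: "'a rel" and C :: "'a set"
  assumes arcs_subset: "A \<subseteq> V \<times> V"
    and centers_subset: "C \<subseteq> V"
    and in_unique: "\<lbrakk>(a, b) \<in> A; (a', b) \<in> A; b \<notin> C\<rbrakk> \<Longrightarrow> a = a'"
    and out_unique: "\<lbrakk>(a, b) \<in> A; (a, b') \<in> A; a \<notin> C\<rbrakk> \<Longrightarrow> b = b'"
    and cover: "v \<in> V \<Longrightarrow> v \<in> C \<or> (\<exists>c\<in>C. (c, v) \<in> A\<^sup>+) \<or> (\<exists>c\<in>C. (v, c) \<in> A\<^sup>+)"
    and no_return: "\<lbrakk>c \<in> C; c' \<in> C\<rbrakk> \<Longrightarrow> (c, c') \<notin> A\<^sup>+"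

text \<open>\<open>Q e\<close> lists the vertices of the path that replaces \<open>e\<close>, and
  \<open>E\<close> is the arc set of the subdivision. With vertex lists, reversing all arcs amounts
  to \<open>rev\<close>.\<close>

locale spider_subdivision = spider_forest V A C
  for V :: "'a set" and A :: "'a rel" and C :: "'a set" +
  fixes \<phi> :: "'a \<Rightarrow> 'b" and Q :: "'a \<times> 'a \<Rightarrow> 'b list" and E :: "'b rel"
  assumes inj: "inj_on \<phi> V"
    and path_distinct: "e \<in> A \<Longrightarrow> distinct (Q e)"
    and path_length: "e \<in> A \<Longrightarrow> 2 \<le> length (Q e)"
    and path_hd: "e \<in> A \<Longrightarrow> hd (Q e) = \<phi> (fst e)"
    and path_last: "e \<in> A \<Longrightarrow> last (Q e) = \<phi> (snd e)"
    and inner_new: "\<lbrakk>e \<in> A; 0 < i; Suc i < length (Q e)\<rbrakk> \<Longrightarrow> Q e ! i \<notin> \<phi> ` V"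
    and inner_disjoint: "\<lbrakk>e \<in> A; f \<in> A; 0 < i; Suc i < length (Q e); 0 < j; Suc j < length (Q f);
      Q e ! i = Q f ! j\<rbrakk> \<Longrightarrow> e = f"
    and arcs_iff: "(x, y) \<in> E \<longleftrightarrow>
      (\<exists>e\<in>A. \<exists>i. Suc i < length (Q e) \<and> x = Q e ! i \<and> y = Q e ! Suc i)"
begin

section \<open>Legs leaving the centres and their subdivisions\<close>

definition out_part :: "'a set" where
  "out_part = {v. \<exists>c\<in>C. (c, v) \<in> A\<^sup>+}"

text \<open>The first vertex of each path is omitted: it is the copy of a centre or the end of the
  preceding path. Thus the subdivided legs are covered without their centres.\<close>

definition out_image :: "'b set" where
  "out_image = {Q e ! Suc i | e i. e \<in> A \<and> snd e \<in> out_part \<and> Suc i < length (Q e)}"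

lemma out_part_not_center: "v \<in> out_part \<Longrightarrow> v \<notin> C"
  using no_return by (auto simp: out_part_def)

lemma out_part_subset: "out_part \<subseteq> V"
  using trancl_subset_Sigma[OF arcs_subset]
  by (auto simp: out_part_def)

lemma out_part_succ: "(a, b) \<in> A \<Longrightarrow> a \<in> C \<union> out_part \<Longrightarrow> b \<in> out_part"
  by (auto simp: out_part_def intro: trancl_into_trancl)

text \<open>A path from a centre to \<open>b\<close> ends with an arc into \<open>b\<close>; as
  \<open>b\<close> is no centre, this arc is \<open>(a, b)\<close>.\<close>

lemma out_part_pred:
  assumes "(a, b) \<in> A" "b \<in> out_part" shows "a \<in> C \<union> out_part"
proof -
  from assms(2) obtain c where c: "c \<in> C" "(c, b) \<in> A\<^sup>+" by (auto simp: out_part_def)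
  then obtain a' where a': "(c, a') \<in> A\<^sup>*" "(a', b) \<in> A" by (meson tranclD2)
  then have "a' = a" using in_unique assms out_part_not_center by blast
  with a' c show ?thesis by (auto simp: out_part_def rtrancl_eq_or_trancl)
qed

lemma out_part_has_pred:
  assumes "b \<in> out_part" obtains a where "(a, b) \<in> A"
  using assms by (auto simp: out_part_def elim: tranclE)

lemma arc_in_V: "e \<in> A \<Longrightarrow> fst e \<in> V" "e \<in> A \<Longrightarrow> snd e \<in> V"
  using arcs_subset by auto

lemma path_first: "e \<in> A \<Longrightarrow> Q e ! 0 = \<phi> (fst e)"
  using path_hd[of e] path_length[of e] hd_conv_nth[of "Q e"] by fastforce

lemma path_end: "e \<in> A \<Longrightarrow> Suc i = length (Q e) \<Longrightarrow> Q e ! i = \<phi> (snd e)"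
  using path_last[of e] last_conv_nth[of "Q e"] by (metis diff_Suc_1 list.size(3) nat.distinct(1))

text \<open>An inner vertex lies inside one path only, and a path end considered here is the copy of
  a non-centre, whose in-arc is unique. Distinctness of \<open>Q e\<close> then fixes the
  position.\<close>

lemma out_image_pred_unique:
  assumes e: "e \<in> A" "snd e \<in> out_part" "Suc i < length (Q e)"
    and f: "f \<in> A" "Suc j < length (Q f)" and eq: "Q f ! Suc j = Q e ! Suc i"
  shows "f = e \<and> j = i"
proof -
  have "f = e"
  proof (cases "Suc (Suc i) = length (Q e)")
    case True
    then have 1: "Q f ! Suc j = \<phi> (snd e)" using eq path_end e(1) by simp
    have "Suc (Suc j) = length (Q f)"
    proof (rule ccontr)
      assume "Suc (Suc j) \<noteq> length (Q f)"
      with f have "Q f ! Suc j \<notin> \<phi> ` V" by (intro inner_new) auto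
      with 1 arc_in_V[OF e(1)] show False by auto
    qed
    then have "\<phi> (snd f) = \<phi> (snd e)" using 1 path_end[OF f(1)] by simp
    then have "snd f = snd e" using inj_onD[OF inj] arc_in_V e(1) f(1) by blast
    moreover from this have "fst f = fst e"
      using in_unique[of "fst f" "snd f" "fst e"] e f out_part_not_center by (metis prod.collapse)
    ultimately show ?thesis by (simp add: prod_eq_iff)
  next
    case False
    with e have "Q e ! Suc i \<notin> \<phi> ` V" by (intro inner_new) auto
    then have "Suc (Suc j) \<noteq> length (Q f)"
      using path_end[OF f(1), of "Suc j"] eq arc_in_V[OF f(1)] by auto
    with False e f eq show ?thesis by (intro inner_disjoint[of f e "Suc j" "Suc i"]) auto
  qed
  with e f eq path_distinct[of e] show ?thesis by (auto simp: nth_eq_iff_index_eq)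
qed

text \<open>This is what later rules out additional arcs between image vertices and drives the
  injectivity proof.\<close>

lemma out_image_in_unique:
  assumes "(x, y) \<in> E" "(x', y) \<in> E" "y \<in> out_image" shows "x = x'"
proof -
  obtain e i where e: "e \<in> A" "snd e \<in> out_part" "Suc i < length (Q e)" "y = Q e ! Suc i"
    using assms(3) by (auto simp: out_image_def)
  have "z = Q e ! i" if z: "(z, y) \<in> E" for z
  proof -
    obtain f j where "f \<in> A" "Suc j < length (Q f)" "z = Q f ! j" "y = Q f ! Suc j"
      using z arcs_iff by auto
    with out_image_pred_unique[OF e(1-3), of f j] e(4) show ?thesis by simp
  qed
  with assms show ?thesis by blast
qed

lemma center_not_in_out_image:
  assumes "c \<in> C" shows "\<phi> c \<notin> out_image"
proof
  assume "\<phi> c \<in> out_image"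
  then obtain e i where e: "e \<in> A" "snd e \<in> out_part" "Suc i < length (Q e)" "\<phi> c = Q e ! Suc i"
    by (auto simp: out_image_def)
  have c: "c \<in> V" using assms centers_subset by blast
  then have "Q e ! Suc i \<in> \<phi> ` V" using e(4) by (metis imageI)
  then have "Suc (Suc i) = length (Q e)" using inner_new[of e "Suc i"] e by linarith
  with e path_end have "\<phi> c = \<phi> (snd e)" by simp
  with inj_onD[OF inj] c arc_in_V e have "c = snd e" by blast
  with assms e out_part_not_center show False by blast
qed

section \<open>Embedding the legs that leave the centres\<close>

definition parent :: "'a \<Rightarrow> 'a" where
  "parent v = (THE u. (u, v) \<in> A)"

lemma parent_eq: "(u, v) \<in> A \<Longrightarrow> v \<in> out_part \<Longrightarrow> parent v = u"
  unfolding parent_def using in_unique out_part_not_center by blast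

text \<open>The number counts the arcs to follow back through parents, and \<open>tl\<close> drops
  the vertex shared by consecutive paths. For a vertex of \<open>C \<union> out_part\<close>,
  \<open>walk (depth v) v\<close> leads from its centre to the copy of \<open>v\<close>.\<close>

primrec walk :: "nat \<Rightarrow> 'a \<Rightarrow> 'b list" where
  "walk 0 v = [\<phi> v]"
| "walk (Suc n) v = walk n (parent v) @ tl (Q (parent v, v))"

definition depth :: "'a \<Rightarrow> nat" where
  "depth v = (LEAST n. \<exists>c\<in>C. (c, v) \<in> A ^^ n)"

lemma depth_path:
  assumes "v \<in> C \<union> out_part" shows "\<exists>c\<in>C. (c, v) \<in> A ^^ depth v"
proof -
  have "\<exists>n. \<exists>c\<in>C. (c, v) \<in> A ^^ n"
  proof (cases "v \<in> C")
    case True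
    then show ?thesis by (intro exI[of _ 0]) auto
  next
    case False
    with assms show ?thesis by (auto simp: out_part_def trancl_power)
  qed
  then show ?thesis unfolding depth_def by (rule LeastI_ex)
qed

lemma depth_center: "c \<in> C \<Longrightarrow> depth c = 0"
  unfolding depth_def by (rule Least_eq_0) auto

text \<open>A shortest path from a centre to \<open>v\<close> must end with \<open>(u, v)\<close>,
  the only arc into \<open>v\<close>; removing that arc gives the lower bound.\<close>

lemma depth_arc:
  assumes "(u, v) \<in> A" "v \<in> out_part" shows "depth v = Suc (depth u)"
proof (rule antisym)
  obtain c where "c \<in> C" "(c, u) \<in> A ^^ depth u"
    using depth_path[OF out_part_pred[OF assms]] by blast
  with assms(1) have "\<exists>c\<in>C. (c, v) \<in> A ^^ Suc (depth u)" by auto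
  then show "depth v \<le> Suc (depth u)" unfolding depth_def[of v] by (rule Least_le)
  obtain c' where c': "c' \<in> C" "(c', v) \<in> A ^^ depth v" using depth_path assms(2) by blast
  with assms(2) out_part_not_center obtain n where n: "depth v = Suc n" by (cases "depth v") auto
  with c' obtain u' where "(c', u') \<in> A ^^ n" "(u', v) \<in> A" by auto
  with c' assms in_unique out_part_not_center have "\<exists>c\<in>C. (c, u) \<in> A ^^ n" by blast
  then have "depth u \<le> n" unfolding depth_def by (rule Least_le)
  with n show "Suc (depth u) \<le> depth v" by simp
qed

lemma walk_arc:
  assumes "(u, v) \<in> A" "v \<in> out_part"
  shows "walk (depth v) v = walk (depth u) u @ tl (Q (u, v))"
  using depth_arc[OF assms] parent_eq[OF assms] by simp

lemma out_induct [consumes 1, case_names center arc]: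
  assumes "v \<in> C \<union> out_part" "\<And>c. c \<in> C \<Longrightarrow> P c"
    "\<And>u v. \<lbrakk>(u, v) \<in> A; v \<in> out_part; u \<in> C \<union> out_part; P u\<rbrakk> \<Longrightarrow> P v"
  shows "P v"
  using assms(1)
proof (induction "depth v" arbitrary: v)
  case 0
  then have "v \<in> C" using depth_path[of v] by auto
  then show ?case by (rule assms(2))
next
  case (Suc n)
  show ?case
  proof (cases "v \<in> C")
    case False
    with Suc.prems have v: "v \<in> out_part" by blast
    then obtain u where u: "(u, v) \<in> A" by (rule out_part_has_pred)
    with depth_arc[OF u v] Suc.hyps(2) have "n = depth u" by simp
    from Suc.hyps(1)[OF this out_part_pred[OF u v]] show ?thesis
      using assms(3)[OF u v out_part_pred[OF u v]] by blast
  qed (rule assms(2))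
qed

text \<open>Each subdivided arc contributes at least one new vertex, so the walk is long enough to
  have a position \<open>depth v\<close>; this justifies the index used in
  \<open>embed\<close>.\<close>

lemma walk_props:
  assumes "v \<in> C \<union> out_part"
  shows "depth v < length (walk (depth v) v) \<and> last (walk (depth v) v) = \<phi> v \<and>
    (\<forall>i. Suc i < length (walk (depth v) v) \<longrightarrow>
      (walk (depth v) v ! i, walk (depth v) v ! Suc i) \<in> E \<and> walk (depth v) v ! Suc i \<in> out_image)"
  using assms
proof (induction rule: out_induct)
  case (center c)
  then show ?case by (simp add: depth_center)
next
  case (arc u v)
  let ?U = "walk (depth u) u" and ?Q = "Q (u, v)"
  have Q: "2 \<le> length ?Q" "?Q ! 0 = \<phi> u" "last ?Q = \<phi> v"
    using path_length path_first path_last arc(1) by auto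
  then have ne: "tl ?Q \<noteq> []" by (cases ?Q rule: list.exhaust) (auto simp: Suc_le_length_iff)
  have lenU: "depth u < length ?U" and lastU: "last ?U = \<phi> u" using arc by auto
  have "((?U @ tl ?Q) ! i, (?U @ tl ?Q) ! Suc i) \<in> E \<and> (?U @ tl ?Q) ! Suc i \<in> out_image"
    if i: "Suc i < length (?U @ tl ?Q)" for i
  proof (cases "Suc i < length ?U")
    case True
    then show ?thesis using arc by (simp add: nth_append)
  next
    case False
    \<comment> \<open>Index \<open>Suc i\<close> of the concatenation is position \<open>j\<close>
      of \<open>tl ?Q\<close>, hence \<open>Suc j\<close> of \<open>?Q\<close>. For
      \<open>j = 0\<close> the preceding vertex is the joint, which is both \<open>last ?U\<close>
      and \<open>?Q ! 0\<close>.\<close>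
    define j where "j = Suc i - length ?U"
    have j: "Suc j < length ?Q" using i False by (auto simp: j_def)
    have 1: "(?U @ tl ?Q) ! Suc i = ?Q ! Suc j"
      using False j by (simp add: nth_append j_def nth_tl)
    have 2: "(?U @ tl ?Q) ! i = ?Q ! j"
    proof (cases j)
      case 0
      with False i lenU have "Suc i = length ?U" by (simp add: j_def)
      then have "(?U @ tl ?Q) ! i = last ?U" by (auto simp: nth_append last_conv_nth)
        (metis diff_Suc_1 last_conv_nth length_0_conv nat.distinct(1))
      then show ?thesis using 0 lastU Q by simp
    next
      case (Suc m)
      with False have "i - length ?U = m" "\<not> i < length ?U" by (auto simp: j_def)
      with Suc j show ?thesis by (simp add: nth_append nth_tl)
    qed
    have "(?Q ! j, ?Q ! Suc j) \<in> E" using arcs_iff arc(1) j by blast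
    moreover have "?Q ! Suc j \<in> out_image" unfolding out_image_def using arc(1,2) j by force
    ultimately show ?thesis unfolding 1 2 by blast
  qed
  moreover have "last (?U @ tl ?Q) = \<phi> v" using ne Q(3) by (simp add: last_tl)
  moreover have "depth v < length (?U @ tl ?Q)"
    using lenU ne by (simp add: depth_arc[OF arc(1,2)]) (metis Suc_lessI add.commute less_add_same_cancel1
      length_greater_0_conv less_trans_Suc add_less_mono One_nat_def length_tl)
  ultimately show ?case unfolding walk_arc[OF arc(1,2)] by blast
qed

text \<open>
  A vertex at distance \<open>d\<close> from its centre is sent to the \<open>d\<close>-th vertex of the subdivided leg, so the
  slack of the subdivision is moved to the far ends of the legs.
\<close>

definition embed :: "'a \<Rightarrow> 'b" where
  "embed v = walk (depth v) v ! depth v"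

lemma embed_center: "c \<in> C \<Longrightarrow> embed c = \<phi> c"
  by (simp add: embed_def depth_center)

text \<open>The walk of \<open>u\<close> is a prefix of the walk of \<open>v\<close>, so both images
  are read off one list at consecutive positions.\<close>

lemma embed_arc:
  assumes "(u, v) \<in> A" "v \<in> out_part"
  shows "(embed u, embed v) \<in> E" "embed v \<in> out_image"
proof -
  note u = walk_props[OF out_part_pred[OF assms]]
  have v: "depth v < length (walk (depth v) v)"
    "\<And>i. Suc i < length (walk (depth v) v) \<Longrightarrow>
      (walk (depth v) v ! i, walk (depth v) v ! Suc i) \<in> E \<and> walk (depth v) v ! Suc i \<in> out_image"
    using walk_props[of v] assms(2) by auto
  have "embed u = walk (depth v) v ! depth u"
    using u by (simp add: embed_def walk_arc[OF assms] nth_append)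
  then show "(embed u, embed v) \<in> E" "embed v \<in> out_image"
    using v(2)[of "depth u"] v(1) by (simp_all add: embed_def depth_arc[OF assms])
qed

lemma embed_out_image: "v \<in> out_part \<Longrightarrow> embed v \<in> out_image"
  using embed_arc(2) out_part_has_pred by blast

text \<open>Equal images have the same unique in-neighbour, so the predecessors have equal images
  and coincide by induction; it remains to compare two out-arcs of one vertex.\<close>

lemma embed_inj: "inj_on embed (C \<union> out_part)"
proof (rule inj_onI)
  fix v v'
  assume "v \<in> C \<union> out_part" "v' \<in> C \<union> out_part" "embed v = embed v'"
  then show "v = v'"
  proof (induction arbitrary: v' rule: out_induct)
    case (center c)
    then have "v' \<in> C"
      using embed_out_image[of v'] center_not_in_out_image[of c] embed_center[of c] by auto
    with center show ?case
      using inj_onD[OF inj] centers_subset by (auto simp: embed_center)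
  next
    case (arc u v)
    then have "v' \<notin> C"
      using embed_out_image[of v] center_not_in_out_image[of v'] embed_center[of v'] by auto
    with arc.prems have v': "v' \<in> out_part" by blast
    then obtain u' where u': "(u', v') \<in> A" by (rule out_part_has_pred)
    have "embed u = embed u'"
      using out_image_in_unique[OF embed_arc(1)[OF arc(1,2)] _ embed_arc(2)[OF arc(1,2)]]
        embed_arc(1)[OF u' v'] arc.prems by simp
    with arc.IH out_part_pred[OF u' v'] have u: "u = u'" by blast
    show ?case
    proof (cases "u \<in> C")
      case False
      then show ?thesis using out_unique arc(1) u' u by blast
    next
      \<comment> \<open>A centre may have several out-arcs. Both vertices then have depth 1 and go
        to the second vertices of their paths, which differ for different arcs.\<close>
      case True
      have "embed w = Q (u, w) ! Suc 0 \<and> Suc 0 < length (Q (u, w))" if "(u, w) \<in> A" "w \<in> out_part" for w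
        using path_length[OF that(1)] depth_arc[OF that] parent_eq[OF that] True
        by (simp add: embed_def depth_center nth_tl)
      with arc u' v' u out_image_pred_unique[of "(u, v)" 0 "(u, v')" 0] show ?thesis by auto
    qed
  qed
qed

section \<open>Reversal of arcs and the embedding of all legs\<close>

lemma reverse:
  "spider_subdivision V (A\<inverse>) C \<phi> (\<lambda>e. rev (Q (snd e, fst e))) (E\<inverse>)"
proof (unfold_locales, goal_cases)
  \<comment> \<open>Goals 5 and 6 are \<open>cover\<close> and \<open>no_return\<close>; 12, 13 and
    14 are \<open>inner_new\<close>, \<open>inner_disjoint\<close> and \<open>arcs_iff\<close>. In
    the last one the two consecutive positions also swap roles, hence the index with two
    successors.\<close>
  case (5 v)
  then show ?case using cover[of v] by (auto simp: trancl_converse)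
next
  case (6 c c')
  then show ?case using no_return[of c' c] by (simp add: trancl_converse)
next
  case (12 e i)
  then show ?case
    using inner_new[of "(snd e, fst e)" "length (Q (snd e, fst e)) - Suc i"]
    by (auto simp: rev_nth converse_iff[symmetric])
next
  case (13 e f i j)
  then show ?case
    using inner_disjoint[of "(snd e, fst e)" "(snd f, fst f)" "length (Q (snd e, fst e)) - Suc i"
      "length (Q (snd f, fst f)) - Suc j"]
    by (auto simp: rev_nth converse_iff[symmetric] prod_eq_iff)
next
  case (14 x y)
  show ?case
  proof
    assume "(x, y) \<in> E\<inverse>"
    then obtain e i where e: "e \<in> A" "Suc i < length (Q e)" "y = Q e ! i" "x = Q e ! Suc i"
      by (auto simp: arcs_iff)
    then show "\<exists>e\<in>A\<inverse>. \<exists>i. Suc i < length (rev (Q (snd e, fst e))) \<and>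
        x = rev (Q (snd e, fst e)) ! i \<and> y = rev (Q (snd e, fst e)) ! Suc i"
      by (intro bexI[of _ "(snd e, fst e)"] exI[of _ "length (Q e) - Suc (Suc i)"])
        (auto simp: rev_nth Suc_diff_Suc)
  next
    assume "\<exists>e\<in>A\<inverse>. \<exists>i. Suc i < length (rev (Q (snd e, fst e))) \<and>
        x = rev (Q (snd e, fst e)) ! i \<and> y = rev (Q (snd e, fst e)) ! Suc i"
    then obtain e i where e: "(snd e, fst e) \<in> A" "Suc i < length (Q (snd e, fst e))"
        "x = Q (snd e, fst e) ! (length (Q (snd e, fst e)) - Suc i)"
        "y = Q (snd e, fst e) ! (length (Q (snd e, fst e)) - Suc (Suc i))"
      by (auto simp: rev_nth)
    then show "(x, y) \<in> E\<inverse>"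
      by (auto simp: arcs_iff intro!: bexI[of _ "(snd e, fst e)"]
          exI[of _ "length (Q (snd e, fst e)) - Suc (Suc i)"] simp: Suc_diff_Suc)
  qed
qed (use arcs_subset centers_subset in_unique out_unique inj path_distinct path_length path_hd path_last
  in \<open>auto simp: hd_rev last_rev\<close>)

text \<open>The two kinds of legs are embedded separately and glued along the centres. The image of
  \<open>V\<close> under \<phi> occurs in the range condition because isolated vertices are missing
  from \<open>Field E\<close>.\<close>

theorem embedding_exists:
  "\<exists>\<psi>. inj_on \<psi> V \<and> \<psi> ` V \<subseteq> \<phi> ` V \<union> Field E \<and> (\<forall>a\<in>V. \<forall>b\<in>V. (a, b) \<in> A \<longleftrightarrow> (\<psi> a, \<psi> b) \<in> E)"
proof -
  interpret R: spider_subdivision V "A\<inverse>" C \<phi> "\<lambda>e. rev (Q (snd e, fst e))" "E\<inverse>"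
    by (rule reverse)
  have V: "V = C \<union> out_part \<union> R.out_part"
    using cover centers_subset out_part_subset R.out_part_subset
    by (auto simp: out_part_def R.out_part_def trancl_converse)
  \<comment> \<open>A common vertex would give a directed path from a centre to a centre.\<close>
  have disj: "out_part \<inter> R.out_part = {}"
    using no_return by (auto simp: out_part_def R.out_part_def trancl_converse dest: trancl_trans)
  have split: "b \<in> out_part \<or> a \<in> R.out_part" if "(a, b) \<in> A" for a b
    using that out_part_succ[of a b] V arcs_subset by auto
  have R_image: "R.out_image = {Q e ! i | e i. e \<in> A \<and> fst e \<in> R.out_part \<and> Suc i < length (Q e)}"
  proof (intro equalityI subsetI)
    fix x assume "x \<in> R.out_image"
    then obtain e i where "(snd e, fst e) \<in> A" "snd e \<in> R.out_part" "Suc i < length (Q (snd e, fst e))"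
        "x = Q (snd e, fst e) ! (length (Q (snd e, fst e)) - Suc (Suc i))"
      by (auto simp: R.out_image_def rev_nth)
    then show "x \<in> {Q e ! i | e i. e \<in> A \<and> fst e \<in> R.out_part \<and> Suc i < length (Q e)}"
      by (intro CollectI exI[of _ "(snd e, fst e)"] exI[of _ "length (Q (snd e, fst e)) - Suc (Suc i)"])
        auto
  next
    fix x assume "x \<in> {Q e ! i | e i. e \<in> A \<and> fst e \<in> R.out_part \<and> Suc i < length (Q e)}"
    then obtain e i where "e \<in> A" "fst e \<in> R.out_part" "Suc i < length (Q e)" "x = Q e ! i" by auto
    then show "x \<in> R.out_image" unfolding R.out_image_def
      by (intro CollectI exI[of _ "(snd e, fst e)"] exI[of _ "length (Q e) - Suc (Suc i)"])
        (auto simp: rev_nth Suc_diff_Suc)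
  qed
  \<comment> \<open>A common vertex is either the copy of a vertex in both parts or inner to one
    path, whose arc would then have its tail both in \<open>C \<union> out_part\<close> and in
    \<open>R.out_part\<close>.\<close>
  have images: "out_image \<inter> R.out_image = {}"
  proof (rule ccontr)
    assume "out_image \<inter> R.out_image \<noteq> {}"
    then obtain e i f j where e: "e \<in> A" "snd e \<in> out_part" "Suc i < length (Q e)"
      and f: "f \<in> A" "fst f \<in> R.out_part" "Suc j < length (Q f)" and eq: "Q e ! Suc i = Q f ! j"
      unfolding out_image_def R_image by blast
    have fste: "fst e \<in> C \<union> out_part" using out_part_pred[of "fst e" "snd e"] e by simp
    show False
    proof (cases "j = 0")
      case True
      then have "Q e ! Suc i = \<phi> (fst f)" using eq path_first[OF f(1)] by simp
      moreover from this have "Suc (Suc i) = length (Q e)"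
        using inner_new[OF e(1), of "Suc i"] e(3) arc_in_V[OF f(1)] by fastforce
      ultimately have "\<phi> (snd e) = \<phi> (fst f)" using path_end[OF e(1)] by simp
      then have "snd e = fst f" using inj_onD[OF inj] arc_in_V e(1) f(1) by blast
      with e f disj show False by auto
    next
      case False
      then have "Q f ! j \<notin> \<phi> ` V" using inner_new f by auto
      then have "Suc (Suc i) \<noteq> length (Q e)"
        using path_end[OF e(1), of "Suc i"] eq arc_in_V[OF e(1)] by auto
      with e f False eq have "e = f" by (intro inner_disjoint[of e f "Suc i" j]) auto
      with fste f disj R.out_part_not_center show False by auto
    qed
  qed
  \<comment> \<open>Both embeddings agree with \<phi> on the centres, so either description of
    \<psi> may be used there.\<close>
  define \<psi> where "\<psi> v = (if v \<in> R.out_part then R.embed v else embed v)" for v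
  have \<psi>_out: "\<psi> v = embed v" if "v \<in> C \<union> out_part" for v
    using that disj R.out_part_not_center by (auto simp: \<psi>_def)
  have \<psi>_in: "\<psi> v = R.embed v" if "v \<in> C \<union> R.out_part" for v
    using that R.out_part_not_center by (auto simp: \<psi>_def embed_center R.embed_center)
  have inj_out: "inj_on \<psi> (C \<union> out_part)"
    using embed_inj by (rule inj_on_cong[THEN iffD1, rotated]) (simp add: \<psi>_out)
  have inj_in: "inj_on \<psi> (C \<union> R.out_part)"
    using R.embed_inj by (rule inj_on_cong[THEN iffD1, rotated]) (simp add: \<psi>_in)
  have ne: "\<psi> v \<noteq> \<psi> v'" if "v \<in> out_part" "v' \<in> R.out_part" for v v'
    using embed_out_image[OF that(1)] R.embed_out_image[OF that(2)] images that
    by (auto simp: \<psi>_out \<psi>_in)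
  have "inj_on \<psi> V"
  proof (rule inj_onI)
    fix v v' assume "v \<in> V" "v' \<in> V" "\<psi> v = \<psi> v'"
    with ne[of v v'] ne[of v' v] inj_onD[OF inj_out, of v v'] inj_onD[OF inj_in, of v v']
    show "v = v'" unfolding V by auto
  qed
  moreover have fwd: "(\<psi> a, \<psi> b) \<in> E" if "(a, b) \<in> A" for a b
    using split[OF that]
  proof
    assume b: "b \<in> out_part"
    with that out_part_pred have "a \<in> C \<union> out_part" by blast
    with embed_arc(1)[OF that b] b show ?thesis by (simp add: \<psi>_out)
  next
    assume a: "a \<in> R.out_part"
    from that have ba: "(b, a) \<in> A\<inverse>" by simp
    with a R.out_part_pred have "b \<in> C \<union> R.out_part" by blast
    with R.embed_arc(1)[OF ba a] a show ?thesis by (simp add: \<psi>_in)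
  qed
  \<comment> \<open>An arc between images enters \<open>out_image\<close> or leaves
    \<open>R.out_image\<close>. In the first case \<open>b\<close> has a predecessor in
    \<open>A\<close>, whose image is the only in-neighbour of the image of \<open>b\<close> and
    hence equals that of \<open>a\<close>; the second case is dual.\<close>
  moreover have "(a, b) \<in> A" if ab: "a \<in> V" "b \<in> V" "(\<psi> a, \<psi> b) \<in> E" for a b
  proof -
    obtain e i where e: "e \<in> A" "Suc i < length (Q e)" "\<psi> a = Q e ! i" "\<psi> b = Q e ! Suc i"
      using ab(3) arcs_iff by auto
    have "snd e \<in> out_part \<or> fst e \<in> R.out_part" using split[of "fst e" "snd e"] e(1) by simp
    then have "\<psi> b \<in> out_image \<or> \<psi> a \<in> R.out_image"
      unfolding R_image out_image_def using e by blast
    then show ?thesis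
    proof
      assume im: "\<psi> b \<in> out_image"
      then have "b \<in> out_part"
        using ab(2) images R.embed_out_image[of b] center_not_in_out_image[of b] embed_center[of b]
          \<psi>_out[of b] \<psi>_in[of b] unfolding V by auto
      then obtain a' where a': "(a', b) \<in> A" by (rule out_part_has_pred)
      have "\<psi> a = \<psi> a'" using out_image_in_unique[OF ab(3) fwd[OF a'] im] .
      with a' ab(1) \<open>inj_on \<psi> V\<close> arcs_subset have "a = a'" by (auto dest: inj_onD)
      with a' show ?thesis by simp
    next
      assume im: "\<psi> a \<in> R.out_image"
      then have "a \<in> R.out_part"
        using ab(1) images embed_out_image[of a] R.center_not_in_out_image[of a] embed_center[of a]
          \<psi>_out[of a] \<psi>_in[of a] unfolding V by auto
      then obtain b' where b': "(a, b') \<in> A" using R.out_part_has_pred by blast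
      have "\<psi> b = \<psi> b'"
        using R.out_image_in_unique[of "\<psi> b" "\<psi> a" "\<psi> b'"] ab(3) fwd[OF b'] im by simp
      with b' ab(2) \<open>inj_on \<psi> V\<close> arcs_subset have "b = b'" by (auto dest: inj_onD)
      with b' show ?thesis by simp
    qed
  qed
  moreover have "\<psi> ` V \<subseteq> \<phi> ` V \<union> Field E"
  proof
    fix x assume "x \<in> \<psi> ` V"
    then obtain v where v: "v \<in> V" "x = \<psi> v" by blast
    show "x \<in> \<phi> ` V \<union> Field E"
    proof (cases "v \<in> C")
      case True
      with v show ?thesis by (simp add: \<psi>_out embed_center)
    next
      case False
      with v V consider "v \<in> out_part" | "v \<in> R.out_part" by blast
      then obtain u where "(u, v) \<in> A \<or> (v, u) \<in> A"
        using out_part_has_pred R.out_part_has_pred by (metis converse_iff)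
      then have "(\<psi> u, \<psi> v) \<in> E \<or> (\<psi> v, \<psi> u) \<in> E" using fwd by blast
      with v(2) show ?thesis by (auto simp: Field_def)
    qed
  qed
  ultimately show ?thesis by blast
qed

end

section \<open>Spiders as rooted structures\<close>

text \<open>A directed cycle is also a cycle of the symmetric closure; lengths 1 and 2 would be a
  loop or a pair of opposite arcs.\<close>

lemma oriented_tree_acyclic:
  assumes "oriented_tree T" shows "(x, x) \<notin> (parcs T)\<^sup>+"
proof
  assume x: "(x, x) \<in> (parcs T)\<^sup>+"
  interpret pair_digraph T using assms by (simp add: oriented_tree_def)
  let ?M = "with_proj (mk_symmetric (with_proj T))"
  from x have "\<exists>p. awalk x p x \<and> p \<noteq> []" using reachable1_awalk by simp
  then obtain p0 where "awalk x p0 x" "p0 \<noteq> []" by blast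
  then have "closed_w p0" by (auto simp: closed_w_def)
  then obtain p where p: "cycle p" using closed_w_imp_cycle by blast
  then obtain u where u: "awalk u p u" "distinct (tl (awalk_verts u p))" "p \<noteq> []"
    unfolding cycle_def by blast
  have "set p \<subseteq> parcs T" "u \<in> pverts T" "pcas u p u" using u(1) by (auto simp: awalk_def)
  moreover have "parcs T \<subseteq> parcs (mk_symmetric (with_proj T))" by (auto simp: mk_symmetric_def)
  ultimately have "pre_digraph.cycle ?M p"
    using u(2,3) unfolding pre_digraph.cycle_def pre_digraph.awalk_def
    by (auto simp: cas_with_proj_eq awalk_verts_with_proj_eq mk_symmetric_def)
  moreover have "3 \<le> length p"
  proof (rule ccontr)
    assume "\<not> 3 \<le> length p"
    \<comment> \<open>\<open>remdups_adj.cases\<close> serves only to split the list into the shapes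
      \<open>[]\<close>, \<open>[x]\<close> and \<open>x # y # xs\<close>.\<close>
    with u(3) consider e where "p = [e]" | e f where "p = [e, f]"
      by (cases p rule: remdups_adj.cases) (auto simp: Suc_le_eq)
    then show False
    proof cases
      case 1
      with \<open>pcas u p u\<close> \<open>set p \<subseteq> parcs T\<close> pair_no_loops[of e] show False by auto
    next
      case 2
      with \<open>pcas u p u\<close> have "f = (snd e, fst e)" by (auto simp: prod_eq_iff)
      with 2 \<open>set p \<subseteq> parcs T\<close> assms show False
        unfolding oriented_tree_def by (metis insert_subset list.set(2) prod.collapse)
    qed
  qed
  ultimately show False using assms unfolding oriented_tree_def by blast
qed

lemma not_is_node_unique:
  assumes "pair_digraph T" "\<not> is_node T v" "v \<in> pverts T"
  shows "(a, v) \<in> parcs T \<Longrightarrow> (a', v) \<in> parcs T \<Longrightarrow> a = a'"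
    and "(v, b) \<in> parcs T \<Longrightarrow> (v, b') \<in> parcs T \<Longrightarrow> b = b'"
proof -
  interpret pair_digraph T by fact
  have "card (in_arcs (with_proj T) v) \<le> Suc 0" "card (out_arcs (with_proj T) v) \<le> Suc 0"
    using assms(2,3) by (auto simp: is_node_def in_degree_def out_degree_def)
  moreover have "finite (in_arcs (with_proj T) v)" "finite (out_arcs (with_proj T) v)"
    by (auto intro: finite_subset[OF _ pair_finite_arcs])
  ultimately have *: "x = y" if "x \<in> in_arcs (with_proj T) v \<and> y \<in> in_arcs (with_proj T) v \<or>
      x \<in> out_arcs (with_proj T) v \<and> y \<in> out_arcs (with_proj T) v" for x y
    using that card_le_Suc0_iff_eq by blast
  show "(a, v) \<in> parcs T \<Longrightarrow> (a', v) \<in> parcs T \<Longrightarrow> a = a'"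
    using *[of "(a, v)" "(a', v)"] by simp
  show "(v, b) \<in> parcs T \<Longrightarrow> (v, b') \<in> parcs T \<Longrightarrow> b = b'"
    using *[of "(v, b)" "(v, b')"] by simp
qed

text \<open>The centre is the node if there is one and an arbitrary vertex otherwise. Covering
  follows from connectedness, and \<open>no_return\<close> from acyclicity.\<close>

lemma spider_imp_spider_forest:
  assumes "spider T"
  shows "\<exists>c\<in>pverts T. spider_forest (pverts T) (parcs T) {c}"
proof -
  have tree: "oriented_tree T" and node: "\<And>u v. is_node T u \<Longrightarrow> is_node T v \<Longrightarrow> u = v"
    using assms by (auto simp: spider_def)
  then interpret pair_digraph T by (simp add: oriented_tree_def)
  have conn: "strongly_connected (with_proj (mk_symmetric (with_proj T)))"
    using tree by (simp add: oriented_tree_def Digraph_Component.connected_def)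
  then have "pverts T \<noteq> {}" by (simp add: strongly_connected_def mk_symmetric_def)
  then obtain c where c: "c \<in> pverts T" "\<And>v. v \<noteq> c \<Longrightarrow> \<not> is_node T v"
    using node unfolding is_node_def by (metis ex_in_conv)
  have in_u: "a = a'" if "(a, b) \<in> parcs T" "(a', b) \<in> parcs T" "b \<noteq> c" for a a' b
    using not_is_node_unique(1)[OF pair_digraph_axioms c(2)] that in_arcsD2 by blast
  have out_u: "b = b'" if "(a, b) \<in> parcs T" "(a, b') \<in> parcs T" "a \<noteq> c" for a b b'
    using not_is_node_unique(2)[OF pair_digraph_axioms c(2)] that in_arcsD1 by blast
  let ?S = "{v. (c, v) \<in> (parcs T)\<^sup>* \<or> (v, c) \<in> (parcs T)\<^sup>*}"
  \<comment> \<open>If \<open>u\<close> reaches \<open>c\<close> and differs from it, the path to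
    \<open>c\<close> starts with the only arc leaving \<open>u\<close>, so the head of that arc
    reaches \<open>c\<close> too; the other direction is dual.\<close>
  have closed: "v \<in> ?S" if "u \<in> ?S" "(u, v) \<in> parcs T \<or> (v, u) \<in> parcs T" for u v
  proof (cases "u = c")
    case True
    with that show ?thesis by auto
  next
    case u: False
    from that(2) show ?thesis
    proof
      assume uv: "(u, v) \<in> parcs T"
      show ?thesis
      proof (cases "(c, u) \<in> (parcs T)\<^sup>*")
        case False
        with that(1) u obtain v' where "(u, v') \<in> parcs T" "(v', c) \<in> (parcs T)\<^sup>*"
          by (auto elim: converse_rtranclE)
        with out_u uv u show ?thesis by blast
      qed (use uv in \<open>auto intro: rtrancl_into_rtrancl\<close>)
    next
      assume vu: "(v, u) \<in> parcs T"
      show ?thesis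
      proof (cases "(u, c) \<in> (parcs T)\<^sup>*")
        case False
        with that(1) u obtain v' where "(v', u) \<in> parcs T" "(c, v') \<in> (parcs T)\<^sup>*"
          by (auto elim: rtranclE)
        with in_u vu u show ?thesis by blast
      qed (use vu in \<open>auto intro: converse_rtrancl_into_rtrancl\<close>)
    qed
  qed
  have "v \<in> ?S" if "v \<in> pverts T" for v
  proof -
    have "c \<rightarrow>\<^sup>*\<^bsub>with_proj (mk_symmetric (with_proj T))\<^esub> v"
      using conn c(1) that by (simp add: strongly_connected_def mk_symmetric_def)
    then have "(c, v) \<in> (parcs (mk_symmetric (with_proj T)))\<^sup>*"
      by (auto simp: reachable_def dest: rtrancl_on_rtranclI)
    then show ?thesis
    proof induction
      case (step y z)
      from step(2) have "(y, z) \<in> parcs T \<or> (z, y) \<in> parcs T" by (auto simp: mk_symmetric_def)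
      with step.IH show ?case by (rule closed)
    qed simp
  qed
  then have "spider_forest (pverts T) (parcs T) {c}"
    using c(1) in_u out_u oriented_tree_acyclic[OF tree, of c] in_arcsD1 in_arcsD2
    by unfold_locales (auto simp: rtrancl_eq_or_trancl)
  with c(1) show ?thesis by blast
qed

lemma disjoint_union_imp_spider_forest:
  assumes "disjoint_union_of_spiders D"
  obtains C where "spider_forest (pverts D) (parcs D) C"
proof -
  obtain F where F: "\<forall>T\<in>F. spider T" and disj: "\<forall>S\<in>F. \<forall>T\<in>F. S \<noteq> T \<longrightarrow> pverts S \<inter> pverts T = {}"
    and V: "pverts D = (\<Union>T\<in>F. pverts T)" and A: "parcs D = (\<Union>T\<in>F. parcs T)"
    using assms unfolding disjoint_union_of_spiders_def by (elim exE conjE) (rule that)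
  have "\<forall>T\<in>F. \<exists>c. c \<in> pverts T \<and> spider_forest (pverts T) (parcs T) {c}"
    using F spider_imp_spider_forest by blast
  then obtain c where c: "\<And>T. T \<in> F \<Longrightarrow> c T \<in> pverts T"
    "\<And>T. T \<in> F \<Longrightarrow> spider_forest (pverts T) (parcs T) {c T}" by metis
  have sub: "parcs T \<subseteq> pverts T \<times> pverts T" if "T \<in> F" for T
    using c(2)[OF that] by (rule spider_forest.arcs_subset)
  have same: "S = T" if "S \<in> F" "T \<in> F" "v \<in> pverts S" "v \<in> pverts T" for S T v
    using that disj by blast
  have arc: "(a, b) \<in> parcs T" if "(a, b) \<in> parcs D" "T \<in> F" "a \<in> pverts T \<or> b \<in> pverts T" for a b T
  proof -
    from that(1) A obtain S where "S \<in> F" "(a, b) \<in> parcs S" by blast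
    with sub same that show ?thesis by blast
  qed
  \<comment> \<open>Directed paths stay within one spider, so a path between two centres would join
    a centre to itself.\<close>
  have walk: "(a, b) \<in> (parcs T)\<^sup>+ \<and> b \<in> pverts T"
    if "(a, b) \<in> (parcs D)\<^sup>+" "T \<in> F" "a \<in> pverts T" for a b T
    using that(1)
  proof induction
    case (base b)
    with arc that sub show ?case by blast
  next
    case (step b d)
    then have "(b, d) \<in> parcs T" using arc that by blast
    with step.IH sub that show ?case by (auto intro: trancl_into_trancl)
  qed
  have "spider_forest (pverts D) (parcs D) (c ` F)"
  proof
    show "parcs D \<subseteq> pverts D \<times> pverts D"
    proof
      fix e assume "e \<in> parcs D"
      then obtain T where "T \<in> F" "e \<in> parcs T" using A by blast
      then have "pverts T \<subseteq> pverts D" "e \<in> pverts T \<times> pverts T" using V sub by auto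
      then show "e \<in> pverts D \<times> pverts D" by auto
    qed
    show "c ` F \<subseteq> pverts D" using c(1) unfolding V by blast
  next
    fix a b a' assume *: "(a, b) \<in> parcs D" "(a', b) \<in> parcs D" "b \<notin> c ` F"
    then obtain T where T: "T \<in> F" "(a, b) \<in> parcs T" using A by blast
    with arc[OF *(2) T(1)] sub have "(a', b) \<in> parcs T" by blast
    with T * show "a = a'" using spider_forest.in_unique[OF c(2)] by blast
  next
    fix a b b' assume *: "(a, b) \<in> parcs D" "(a, b') \<in> parcs D" "a \<notin> c ` F"
    then obtain T where T: "T \<in> F" "(a, b) \<in> parcs T" using A by blast
    with arc[OF *(2) T(1)] sub have "(a, b') \<in> parcs T" by blast
    with T * show "b = b'" using spider_forest.out_unique[OF c(2)] by blast
  next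
    fix v assume "v \<in> pverts D"
    then obtain T where T: "T \<in> F" "v \<in> pverts T" using V by blast
    moreover have "(parcs T)\<^sup>+ \<subseteq> (parcs D)\<^sup>+" using T A by (intro trancl_mono_subset) blast
    ultimately show "v \<in> c ` F \<or> (\<exists>c\<in>c ` F. (c, v) \<in> (parcs D)\<^sup>+) \<or> (\<exists>c\<in>c ` F. (v, c) \<in> (parcs D)\<^sup>+)"
      using spider_forest.cover[OF c(2)[OF T(1)] T(2)] by blast
  next
    fix x y assume "x \<in> c ` F" "y \<in> c ` F"
    then obtain S T where "S \<in> F" "T \<in> F" "x = c S" "y = c T" by blast
    then show "(x, y) \<notin> (parcs D)\<^sup>+"
      using walk[of x y S] same[of S T y] c(1) spider_forest.no_return[OF c(2), of S x x] by auto
  qed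
  then show ?thesis by (rule that)
qed

section \<open>From arc walks to vertex lists\<close>

lemma pcas_nth:
  assumes "pcas u p v" "i < length p"
  shows "p ! i = (pawalk_verts u p ! i, pawalk_verts u p ! Suc i)"
  using assms
proof (induction p arbitrary: u i)
  case (Cons e p)
  then show ?case
    by (cases i; cases p) (auto simp: prod_eq_iff)
qed simp

lemma length_pawalk_verts: "length (pawalk_verts u p) = Suc (length p)"
  by (induction p arbitrary: u) auto

lemma pawalk_verts_hd_last:
  assumes "pcas u p v"
  shows "hd (pawalk_verts u p) = u" "last (pawalk_verts u p) = v"
proof -
  have "pawalk_verts a q \<noteq> []" for a and q :: "('a \<times> 'a) list" by (cases q) auto
  with assms show "hd (pawalk_verts u p) = u" "last (pawalk_verts u p) = v"
    by (induction p arbitrary: u) auto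
qed

text \<open>The left-hand side is \<open>inner_verts\<close> unfolded: the tails of all arcs but the
  first.\<close>

lemma inner_verts_eq_nths:
  "set (tl (map fst p)) = {pawalk_verts u p ! i | i. 0 < i \<and> Suc i < length (pawalk_verts u p)}"
proof -
  have nth: "i < length p \<Longrightarrow> pawalk_verts u p ! i = fst (p ! i)" for i
    by (induction p arbitrary: u i) (auto simp: nth_Cons split: nat.split)
  show ?thesis
  proof (intro equalityI subsetI)
    fix x assume "x \<in> set (tl (map fst p))"
    then obtain i where "i < length p - 1" "x = fst (p ! Suc i)"
      by (auto simp: in_set_conv_nth nth_tl)
    then have "Suc i < length p" "x = fst (p ! Suc i)" by simp_all
    then show "x \<in> {pawalk_verts u p ! i | i. 0 < i \<and> Suc i < length (pawalk_verts u p)}"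
      by (intro CollectI exI[of _ "Suc i"]) (simp add: length_pawalk_verts nth)
  next
    fix x assume "x \<in> {pawalk_verts u p ! i | i. 0 < i \<and> Suc i < length (pawalk_verts u p)}"
    then obtain i where "Suc i < length p" "x = fst (p ! Suc i)"
      by (auto simp: length_pawalk_verts nth gr0_conv_Suc)
    then have "i < length (tl (map fst p))" "x = tl (map fst p) ! i" by (auto simp: nth_tl)
    then show "x \<in> set (tl (map fst p))" using nth_mem by blast
  qed
qed

text \<open>Equivalently, \<psi> is an isomorphism from \<open>D\<close> onto the subdigraph of
  \<open>G\<close> induced by its image.\<close>

definition induced_embedding :: "'a pair_pre_digraph \<Rightarrow> 'b pair_pre_digraph \<Rightarrow> ('a \<Rightarrow> 'b) \<Rightarrow> bool" where
  "induced_embedding D G \<psi> \<longleftrightarrow> inj_on \<psi> (pverts D) \<and> \<psi> ` pverts D \<subseteq> pverts G \<and>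
     (\<forall>a\<in>pverts D. \<forall>b\<in>pverts D. (a, b) \<in> parcs D \<longleftrightarrow> (\<psi> a, \<psi> b) \<in> parcs G)"

text \<open>The vertex lists of the paths \<open>P e\<close> instantiate \<open>Q\<close>;
  well-formedness puts the ends of all arcs into \<open>pverts H\<close>.\<close>

lemma subdivision_of_spiders_embedding:
  assumes D: "spider_forest (pverts D) (parcs D) C"
    and "subdivision_of D H" and wf: "wf_digraph (with_proj H)"
  shows "\<exists>\<psi>. induced_embedding D H \<psi>"
proof -
  from assms(2) obtain \<phi> P where inj: "inj_on \<phi> (pverts D)"
    and P: "\<forall>(a, b) \<in> parcs D.
      pre_digraph.apath (with_proj H) (\<phi> a) (P (a, b)) (\<phi> b) \<and> 1 \<le> length (P (a, b))"
    and inner: "\<forall>e\<in>parcs D. set (tl (map fst (P e))) \<inter> \<phi> ` pverts D = {}"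
    and disj: "\<forall>e\<in>parcs D. \<forall>f\<in>parcs D. e \<noteq> f \<longrightarrow>
      set (tl (map fst (P e))) \<inter> set (tl (map fst (P f))) = {}"
    and VH: "pverts H = \<phi> ` pverts D \<union> (\<Union>e\<in>parcs D. set (tl (map fst (P e))))"
    and AH: "parcs H = (\<Union>e\<in>parcs D. set (P e))"
    unfolding subdivision_of_def inner_verts_with_proj_def by (elim exE conjE) (rule that)
  define Q where "Q e = pawalk_verts (\<phi> (fst e)) (P e)" for e
  have cas: "pcas (\<phi> (fst e)) (P e) (\<phi> (snd e))" and dist: "distinct (Q e)" and ne: "1 \<le> length (P e)"
    if "e \<in> parcs D" for e
    using bspec[OF P that]
    by (auto simp: pre_digraph.apath_def pre_digraph.awalk_def cas_with_proj_eq
      awalk_verts_with_proj_eq Q_def)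
  have set_inner: "set (tl (map fst (P e))) = {Q e ! i | i. 0 < i \<and> Suc i < length (Q e)}" for e
    unfolding Q_def by (rule inner_verts_eq_nths)
  interpret F: spider_forest "pverts D" "parcs D" C by (rule D)
  interpret spider_subdivision "pverts D" "parcs D" C \<phi> Q "parcs H"
  proof
    show "inj_on \<phi> (pverts D)" by (rule inj)
  next
    fix e assume e: "e \<in> parcs D"
    show "distinct (Q e)" using dist[OF e] .
    show "2 \<le> length (Q e)" using ne[OF e] by (simp add: Q_def length_pawalk_verts)
    show "hd (Q e) = \<phi> (fst e)" "last (Q e) = \<phi> (snd e)"
      using pawalk_verts_hd_last[OF cas[OF e]] by (simp_all add: Q_def)
  next
    fix e i assume "e \<in> parcs D" "0 < i" "Suc i < length (Q e)"
    with inner show "Q e ! i \<notin> \<phi> ` pverts D" unfolding set_inner by blast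
  next
    fix e f i j assume "e \<in> parcs D" "f \<in> parcs D" "0 < i" "Suc i < length (Q e)" "0 < j"
      "Suc j < length (Q f)" "Q e ! i = Q f ! j"
    with disj show "e = f" unfolding set_inner by blast
  next
    fix x y
    have "(x, y) \<in> set (P e) \<longleftrightarrow> (\<exists>i. Suc i < length (Q e) \<and> x = Q e ! i \<and> y = Q e ! Suc i)"
      if "e \<in> parcs D" for e
      using pcas_nth[OF cas[OF that]]
      by (fastforce simp: in_set_conv_nth Q_def length_pawalk_verts)
    then show "(x, y) \<in> parcs H \<longleftrightarrow>
        (\<exists>e\<in>parcs D. \<exists>i. Suc i < length (Q e) \<and> x = Q e ! i \<and> y = Q e ! Suc i)"
      unfolding AH by blast
  qed
  have "Field (parcs H) \<subseteq> pverts H"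
    using wf_digraph.tail_in_verts[OF wf] wf_digraph.head_in_verts[OF wf] by (force simp: Field_def)
  then have "\<phi> ` pverts D \<union> Field (parcs H) \<subseteq> pverts H" using VH by blast
  moreover obtain \<psi> where "inj_on \<psi> (pverts D)" "\<psi> ` pverts D \<subseteq> \<phi> ` pverts D \<union> Field (parcs H)"
    "\<forall>a\<in>pverts D. \<forall>b\<in>pverts D. (a, b) \<in> parcs D \<longleftrightarrow> (\<psi> a, \<psi> b) \<in> parcs H"
    using embedding_exists by (elim exE conjE)
  ultimately have "induced_embedding D H \<psi>"
    unfolding induced_embedding_def by (intro conjI) (assumption | rule order_trans)+
  then show ?thesis by (rule exI[of _ \<psi>])
qed

lemma contains_induced_subdivision_spiders_iff:
  assumes D: "pair_digraph D" "disjoint_union_of_spiders D" and G: "pair_digraph G"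
  shows "contains_induced_subdivision G D \<longleftrightarrow> (\<exists>\<psi>. induced_embedding D G \<psi>)"
proof
  assume "contains_induced_subdivision G D"
  then obtain H where H: "induced_subgraph (with_proj H) (with_proj G)" "subdivision_of D H"
    unfolding contains_induced_subdivision_def by blast
  obtain C where C: "spider_forest (pverts D) (parcs D) C"
    using disjoint_union_imp_spider_forest[OF D(2)] .
  have "wf_digraph (with_proj H)" using H(1) unfolding induced_subgraph_def subgraph_def by blast
  from subdivision_of_spiders_embedding[OF C H(2) this]
  obtain \<psi> where \<psi>: "induced_embedding D H \<psi>" by blast
  have VH: "pverts H \<subseteq> pverts G" and AH: "parcs H = {e \<in> parcs G. fst e \<in> pverts H \<and> snd e \<in> pverts H}"
    using H(1) unfolding induced_subgraph_def subgraph_def with_proj_simps by blast+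
  have "induced_embedding D G \<psi>"
    unfolding induced_embedding_def
  proof (intro conjI ballI)
    show "inj_on \<psi> (pverts D)" "\<psi> ` pverts D \<subseteq> pverts G"
      using \<psi> VH unfolding induced_embedding_def by (blast, blast)
    fix a b assume "a \<in> pverts D" "b \<in> pverts D"
    with \<psi> have "\<psi> a \<in> pverts H" "\<psi> b \<in> pverts H" "(a, b) \<in> parcs D \<longleftrightarrow> (\<psi> a, \<psi> b) \<in> parcs H"
      unfolding induced_embedding_def by blast+
    then show "(a, b) \<in> parcs D \<longleftrightarrow> (\<psi> a, \<psi> b) \<in> parcs G" unfolding AH by simp
  qed
  then show "\<exists>\<psi>. induced_embedding D G \<psi>" by (rule exI[of _ \<psi>])
next
  assume "\<exists>\<psi>. induced_embedding D G \<psi>"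
  then obtain \<psi> where inj: "inj_on \<psi> (pverts D)" and sub: "\<psi> ` pverts D \<subseteq> pverts G"
    and arcs: "\<And>a b. a \<in> pverts D \<Longrightarrow> b \<in> pverts D \<Longrightarrow> (a, b) \<in> parcs D \<longleftrightarrow> (\<psi> a, \<psi> b) \<in> parcs G"
    unfolding induced_embedding_def by blast
  interpret D: pair_digraph D by (rule D(1))
  interpret G: pair_digraph G by (rule G)
  \<comment> \<open>The converse uses the trivial subdivision, in which every arc is replaced by a
    path of length 1.\<close>
  define H where "H = \<lparr>pverts = \<psi> ` pverts D, parcs = map_prod \<psi> \<psi> ` parcs D\<rparr>"
  have DV: "a \<in> pverts D" "b \<in> pverts D" if "(a, b) \<in> parcs D" for a b
    using that D.in_arcsD1 D.in_arcsD2 by blast+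
  have parcsH: "parcs H = {e \<in> parcs G. fst e \<in> pverts H \<and> snd e \<in> pverts H}"
  proof (intro equalityI subsetI)
    fix e assume "e \<in> parcs H"
    then obtain a b where "(a, b) \<in> parcs D" "e = (\<psi> a, \<psi> b)" by (auto simp: H_def)
    with arcs[of a b] DV[of a b] show "e \<in> {e \<in> parcs G. fst e \<in> pverts H \<and> snd e \<in> pverts H}"
      by (simp add: H_def)
  next
    fix e assume "e \<in> {e \<in> parcs G. fst e \<in> pverts H \<and> snd e \<in> pverts H}"
    then obtain a b where ab: "a \<in> pverts D" "b \<in> pverts D" "e = (\<psi> a, \<psi> b)" "e \<in> parcs G"
      by (cases e) (auto simp: H_def)
    then have "(a, b) \<in> parcs D" using arcs by blast
    then have "map_prod \<psi> \<psi> (a, b) \<in> map_prod \<psi> \<psi> ` parcs D" by (rule imageI)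
    with ab(3) show "e \<in> parcs H" by (simp add: H_def)
  qed
  \<comment> \<open>A single arc is an \<open>apath\<close> only if its ends differ.\<close>
  have ne: "\<psi> a \<noteq> \<psi> b" if "(a, b) \<in> parcs D" for a b
    using inj_onD[OF inj _ DV[OF that]] D.pair_no_loops[OF that] by auto
  have "wf_digraph (with_proj H)" by unfold_locales (auto simp: parcsH)
  then have "induced_subgraph (with_proj H) (with_proj G)"
    using sub parcsH G.wf_digraph_axioms
    unfolding induced_subgraph_def subgraph_def with_proj_simps by (auto simp: H_def)
  moreover have "subdivision_of D H"
    unfolding subdivision_of_def inner_verts_with_proj_def
  proof (intro exI[of _ \<psi>] exI[of _ "\<lambda>e. [map_prod \<psi> \<psi> e]"] conjI)
    show "\<forall>(a, b)\<in>parcs D. pre_digraph.apath (with_proj H) (\<psi> a) [map_prod \<psi> \<psi> (a, b)] (\<psi> b) \<and>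
        1 \<le> length [map_prod \<psi> \<psi> (a, b)]"
    proof clarify
      fix a b assume ab: "(a, b) \<in> parcs D"
      then have "(\<psi> a, \<psi> b) \<in> parcs H" "\<psi> a \<in> pverts H" using DV(1) by (force simp: H_def)+
      with ne[OF ab] show "pre_digraph.apath (with_proj H) (\<psi> a) [map_prod \<psi> \<psi> (a, b)] (\<psi> b) \<and>
        1 \<le> length [map_prod \<psi> \<psi> (a, b)]"
        by (simp add: pre_digraph.apath_def pre_digraph.awalk_def cas_with_proj_eq
          awalk_verts_with_proj_eq)
    qed
  qed (simp_all add: inj H_def UNION_singleton_eq_range)
  ultimately have "induced_subgraph (with_proj H) (with_proj G) \<and> subdivision_of D H" ..
  then show "contains_induced_subdivision G D"
    unfolding contains_induced_subdivision_def by (rule exI[of _ H])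
qed

section \<open>The decision problem\<close>

lemma adjacency_word_props:
  assumes "input_digraph G"
  defines "n \<equiv> card (pverts G)"
  shows "length (adjacency_word G) = n * n"
    and "u < n \<Longrightarrow> v < n \<Longrightarrow> adjacency_word G ! (u * n + v) \<longleftrightarrow> (u, v) \<in> parcs G"
proof -
  \<comment> \<open>The number \<open>m\<close> of rows is separated from the row length
    \<open>n\<close> to permit induction on the rows.\<close>
  have len: "length (concat (map (\<lambda>u. map (f u) [0..<n]) [0..<m])) = m * n" for f :: "nat \<Rightarrow> nat \<Rightarrow> bool" and m
    by (induction m) auto
  then show "length (adjacency_word G) = n * n" by (simp add: adjacency_word_def n_def Let_def)
  have "concat (map (\<lambda>u. map (f u) [0..<n]) [0..<m]) ! (u * n + v) = f u v"
    if "u < m" "v < n" for f :: "nat \<Rightarrow> nat \<Rightarrow> bool" and m u v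
    using that
  proof (induction m)
    case (Suc m)
    show ?case
    proof (cases "u < m")
      case True
      then have "u * n + v < m * n"
        using Suc.prems(2) mult_le_mono1[of "Suc u" m n] by simp
      with Suc True show ?thesis by (simp add: nth_append len)
    next
      case False
      with Suc.prems have "u = m" by simp
      with Suc.prems show ?thesis by (simp add: nth_append len)
    qed
  qed simp
  then show "adjacency_word G ! (u * n + v) \<longleftrightarrow> (u, v) \<in> parcs G" if "u < n" "v < n"
    using that by (simp add: adjacency_word_def n_def Let_def)
qed

text \<open>Off the diagonal every bit pattern is allowed, since 2-cycles are; the diagonal
  condition excludes loops.\<close>

lemma ex_adjacency_word:
  assumes "length w = n * n" "\<forall>u<n. \<not> w ! (u * n + u)"
  obtains G where "input_digraph G" "card (pverts G) = n" "adjacency_word G = w"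
proof -
  define G where "G = \<lparr>pverts = {0..<n}, parcs = {(u, v). u < n \<and> v < n \<and> w ! (u * n + v)}\<rparr>"
  have "finite (parcs G)"
    by (rule finite_subset[of _ "{0..<n} \<times> {0..<n}"]) (auto simp: G_def)
  then have G: "input_digraph G" "card (pverts G) = n"
    unfolding input_digraph_def by (auto simp: G_def assms(2) intro!: pair_digraph.intro
      pair_fin_digraph.intro pair_wf_digraph.intro pair_loopfree_digraph.intro
      pair_fin_digraph_axioms.intro pair_loopfree_digraph_axioms.intro)
  have "adjacency_word G = w"
  proof (rule nth_equalityI)
    show "length (adjacency_word G) = length w"
      using adjacency_word_props(1)[OF G(1)] G(2) assms(1) by simp
    fix i assume "i < length (adjacency_word G)"
    then have i: "i < n * n" using adjacency_word_props(1)[OF G(1)] G(2) by simp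
    then have "0 < n" by (cases n) auto
    with i have "i div n < n" "i mod n < n" by (auto simp: less_mult_imp_div_less)
    with adjacency_word_props(2)[OF G(1), of "i div n" "i mod n"] G(2)
    show "adjacency_word G ! i = w ! i" by (simp add: G_def)
  qed
  with G that show ?thesis by blast
qed

text \<open>The enumeration \<open>h\<close> turns maps on the vertices of \<open>D\<close> into
  \<open>k\<close>-tuples of vertex numbers, the form in which the algorithm searches.\<close>

lemma induced_subdivision_problem_spiders:
  assumes D: "pair_digraph D" "disjoint_union_of_spiders D"
    and h: "bij_betw h {..<k} (pverts D)"
  shows "induced_subdivision_problem D =
    {w. \<exists>n. n * n = length w \<and> (\<forall>u<n. \<not> w ! (u * n + u)) \<and>
     (\<exists>x. (\<forall>i<k. x i < n) \<and>
       (\<forall>i<k. \<forall>j<k. (x i = x j \<longleftrightarrow> i = j) \<and> (w ! (x i * n + x j) \<longleftrightarrow> (h i, h j) \<in> parcs D)))}"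
    (is "_ = ?R")
proof (intro equalityI subsetI)
  fix w assume "w \<in> induced_subdivision_problem D"
  then obtain G where w: "w = adjacency_word G" and G: "input_digraph G"
    and sub: "contains_induced_subdivision G D"
    unfolding induced_subdivision_problem_def by blast
  define n where "n = card (pverts G)"
  have Gp: "pair_digraph G" and V: "pverts G = {0..<n}"
    using G by (auto simp: input_digraph_def n_def)
  obtain \<psi> where \<psi>: "inj_on \<psi> (pverts D)" "\<psi> ` pverts D \<subseteq> {0..<n}"
    "\<forall>a\<in>pverts D. \<forall>b\<in>pverts D. (a, b) \<in> parcs D \<longleftrightarrow> (\<psi> a, \<psi> b) \<in> parcs G"
    using sub unfolding contains_induced_subdivision_spiders_iff[OF D Gp] induced_embedding_def V
    by blast
  have hV: "h i \<in> pverts D" if "i < k" for i using h that by (auto simp: bij_betw_def)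
  have lt: "\<psi> (h i) < n" if "i < k" for i using \<psi>(2) hV[OF that] by auto
  have "\<psi> (h i) = \<psi> (h j) \<longleftrightarrow> i = j" if "i < k" "j < k" for i j
    using that h inj_onD[OF \<psi>(1), of "h i" "h j"] hV by (auto simp: bij_betw_def dest: inj_onD)
  moreover have "w ! (\<psi> (h i) * n + \<psi> (h j)) \<longleftrightarrow> (h i, h j) \<in> parcs D" if "i < k" "j < k" for i j
    using adjacency_word_props(2)[OF G, folded n_def, OF lt lt] that hV \<psi>(3) w by simp
  moreover have "\<not> w ! (u * n + u)" if "u < n" for u
    using adjacency_word_props(2)[OF G, folded n_def, OF that that] w
      pair_loopfree_digraph.pair_no_loops[of G "(u, u)"] Gp by (auto simp: pair_digraph_def)
  moreover have "n * n = length w" using adjacency_word_props(1)[OF G] w by (simp add: n_def)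
  ultimately show "w \<in> ?R" using lt by (intro CollectI exI[of _ n] conjI exI[of _ "\<lambda>i. \<psi> (h i)"]) auto
next
  fix w assume "w \<in> ?R"
  then obtain n x where n: "n * n = length w" "\<forall>u<n. \<not> w ! (u * n + u)"
    and x: "\<forall>i<k. x i < n" "\<forall>i<k. \<forall>j<k. (x i = x j \<longleftrightarrow> i = j) \<and>
      (w ! (x i * n + x j) \<longleftrightarrow> (h i, h j) \<in> parcs D)" by blast
  obtain G where G: "input_digraph G" "card (pverts G) = n" "adjacency_word G = w"
    using ex_adjacency_word[OF n(1)[symmetric] n(2)] .
  then have Gp: "pair_digraph G" and V: "pverts G = {0..<n}" by (auto simp: input_digraph_def)
  define g where "g = inv_into {..<k} h"
  have g: "g a < k" "h (g a) = a" if "a \<in> pverts D" for a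
    using that h inv_into_into[of a h "{..<k}"] f_inv_into_f[of a h "{..<k}"]
    by (auto simp: g_def bij_betw_def)
  have "induced_embedding D G (\<lambda>a. x (g a))"
    unfolding induced_embedding_def
  proof (intro conjI ballI)
    show "inj_on (\<lambda>a. x (g a)) (pverts D)" 
      using x(2) g by (intro inj_onI) metis
    show "(\<lambda>a. x (g a)) ` pverts D \<subseteq> pverts G" using x(1) g V by auto
    fix a b assume ab: "a \<in> pverts D" "b \<in> pverts D"
    then have "x (g a) < n" "x (g b) < n" using x(1) g(1) by blast+
    then have "(x (g a), x (g b)) \<in> parcs G \<longleftrightarrow> w ! (x (g a) * n + x (g b))"
      using adjacency_word_props(2)[OF G(1), of "x (g a)" "x (g b)"] G(2,3) by simp
    also have "\<dots> \<longleftrightarrow> (h (g a), h (g b)) \<in> parcs D" using x(2) g(1) ab by blast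
    finally show "(a, b) \<in> parcs D \<longleftrightarrow> (x (g a), x (g b)) \<in> parcs G" using g(2) ab by simp
  qed
  then have "contains_induced_subdivision G D"
    using contains_induced_subdivision_spiders_iff[OF D Gp] by blast
  with G show "w \<in> induced_subdivision_problem D"
    unfolding induced_subdivision_problem_def by blast
qed

theorem proposition1:
  fixes D :: "'a pair_pre_digraph"
  assumes "pair_digraph D"
    and "disjoint_union_of_spiders D"
  shows "polynomial_time_solvable (induced_subdivision_problem D)"
proof -
  have "finite (pverts D)"
    using assms(1) by (simp add: pair_digraph_def pair_fin_digraph_def pair_fin_digraph_axioms_def)
  then obtain h where "bij_betw h {..<card (pverts D)} (pverts D)"
    using ex_bij_betw_nat_finite by (metis atLeast0LessThan)
  from induced_subdivision_problem_spiders[OF assms this] show ?thesis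
    by (simp only: polynomial_time_induced_embedding)
qed

end
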